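(* (Upper bound.) For every $0<\gamma<1$ there is a constant $C_\gamma$, depending only on $\gamma$, such that for every $\gamma$-sparse family $\mathcal S$ of intervals in $\mathbb R$ and every $A_2$ weight $w$ on $\mathbb R$, $$\|\mathcal A^*_{\mathcal S}\|_{L^2(w)\to L^{2,\infty}(w)}\le C_\gamma\,[w]_{A_2}^{3/2}.$$ (Sharpness.) The inequality is sharp in the following sense: there exist a sparse family $\mathcal S$ of intervals in $\mathbb R$ and a sequence of $A_2$ weights $w_\alpha$ (indexed by positive parameters $\alpha$ tending to $0$) such that $$[w_\alpha]_{A_2}\to\infty\quad\text{as }\alpha\to0,$$ and for every function $\phi:[0,\infty)\to[0,\infty)$ with $\phi(x)/x^{3/2}\to0$ as $x\to\infty$, $$\frac{\|\mathcal A^*_{\mathcal S}\|_{L^2(w_\alpha)\to L^{2,\infty}(w_\alpha)}}{\phi([w_\alpha]_{A_2})}\to\infty\quad\text{as }\alpha\to0,$$ where the quotient is read as $+\infty$ if its denominator is $0$.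
   Context: Intervals are bounded intervals of $\mathbb R$ of positive length, and $|\cdot|$ is Lebesgue measure. A weight is a positive measurable function $w$ on $\mathbb R$. It is an $A_2$ weight if $$[w]_{A_2}:=\sup_I\Big(\frac1{|I|}\int_I w\Big)\Big(\frac1{|I|}\int_I w^{-1}\Big)<\infty,$$ the supremum being over all intervals $I$. A family $\mathcal S$ of intervals is called $\gamma$-sparse ($0<\gamma<1$) if there exist pairwise disjoint measurable subsets $E_A\subset A$, $A\in\mathcal S$, with $|E_A|\ge\gamma|A|$. It is called sparse if it is $\gamma$-sparse for some $\gamma\in(0,1)$. For an interval $B$ set $\langle f\rangle_B:=\frac1{|B|}\int_B|f|$ and $M_Bf:=\sup\{\langle f\rangle_A: A\text{ an interval},\ A\supset B\}$. The strong-sparse operator associated with a sparse family $\mathcal S$ is $$\mathcal A^*_{\mathcal S}f(x):=\sum_{A\in\mathcal S}(M_Af)\,\mathbf 1_A(x).$$ Norms: $\|f\|_{L^2(w)}=\big(\int_{\mathbb R}|f|^2w\big)^{1/2}$ and $\|f\|_{L^{2,\infty}(w)}=\sup_{\lambda>0}\lambda\, w(\{|f|>\lambda\})^{1/2}$, where $w(E)=\int_Ew$. For a (sublinear) operator $T$, $\|T\|_{L^2(w)\to X}$ is the supremum of $\|Tf\|_X/\|f\|_{L^2(w)}$ over $f\in L^2(w)$, $f\neq0$. *)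

theory Defs
  imports "HOL-Analysis.Analysis"
begin

text \<open>
  Integrals, averages and norms take values in \<^typ>\<open>ennreal\<close>, so that none of the quantities below
  needs an integrability side condition. Intervals may be open, closed or half-open.
\<close>

definition intervals :: "real set set" where
  "intervals = {I. is_interval I \<and> bounded I \<and> emeasure lebesgue I > 0}"

definition avg :: "real set \<Rightarrow> (real \<Rightarrow> real) \<Rightarrow> ennreal" where
  "avg B f = (\<integral>\<^sup>+x\<in>B. ennreal \<bar>f x\<bar> \<partial>lebesgue) / emeasure lebesgue B"

definition weight :: "(real \<Rightarrow> real) \<Rightarrow> bool" where
  "weight w \<longleftrightarrow> w \<in> borel_measurable lebesgue \<and> (\<forall>x. w x > 0)"

definition A2_char :: "(real \<Rightarrow> real) \<Rightarrow> ennreal" where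
  "A2_char w = (SUP I\<in>intervals. avg I w * avg I (\<lambda>x. inverse (w x)))"

definition A2_weight :: "(real \<Rightarrow> real) \<Rightarrow> bool" where
  "A2_weight w \<longleftrightarrow> weight w \<and> A2_char w < top"

definition gamma_sparse :: "real \<Rightarrow> real set set \<Rightarrow> bool" where
  "gamma_sparse \<gamma> S \<longleftrightarrow> S \<subseteq> intervals \<and>
     (\<exists>E. disjoint_family_on E S \<and>
        (\<forall>A\<in>S. E A \<in> sets lebesgue \<and> E A \<subseteq> A \<and>
               emeasure lebesgue (E A) \<ge> ennreal \<gamma> * emeasure lebesgue A))"

definition sparse_family :: "real set set \<Rightarrow> bool" where
  "sparse_family S \<longleftrightarrow> (\<exists>\<gamma>. 0 < \<gamma> \<and> \<gamma> < 1 \<and> gamma_sparse \<gamma> S)"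

definition max_avg :: "real set \<Rightarrow> (real \<Rightarrow> real) \<Rightarrow> ennreal" where
  "max_avg B f = (SUP A\<in>{A \<in> intervals. B \<subseteq> A}. avg A f)"

definition strong_sparse_op :: "real set set \<Rightarrow> (real \<Rightarrow> real) \<Rightarrow> real \<Rightarrow> ennreal" where
  "strong_sparse_op S f x = (\<Sum>\<^sub>\<infinity>A\<in>S. max_avg A f * indicator A x)"

definition sqrt_ennreal :: "ennreal \<Rightarrow> ennreal" where
  "sqrt_ennreal x = (if x = top then top else ennreal (sqrt (enn2real x)))"

definition L2_norm :: "(real \<Rightarrow> real) \<Rightarrow> (real \<Rightarrow> real) \<Rightarrow> ennreal" where
  "L2_norm w f = sqrt_ennreal (\<integral>\<^sup>+x. ennreal (\<bar>f x\<bar>\<^sup>2 * w x) \<partial>lebesgue)"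

definition weak_L2_norm :: "(real \<Rightarrow> real) \<Rightarrow> (real \<Rightarrow> ennreal) \<Rightarrow> ennreal" where
  "weak_L2_norm w g =
     (SUP l\<in>{0<..}. ennreal l *
        sqrt_ennreal (\<integral>\<^sup>+x\<in>{x. g x > ennreal l}. ennreal (w x) \<partial>lebesgue))"

text \<open>
  Elements of \<open>L\<^sup>2(w)\<close> are classes modulo null sets, hence \<open>f \<noteq> 0\<close> is rendered as
  \<^term>\<open>L2_norm w f > 0\<close>.
\<close>

definition op_norm_L2 ::
    "(real \<Rightarrow> real) \<Rightarrow> ('b \<Rightarrow> ennreal) \<Rightarrow> ((real \<Rightarrow> real) \<Rightarrow> 'b) \<Rightarrow> ennreal" where
  "op_norm_L2 w N T =
     (SUP f\<in>{f \<in> borel_measurable lebesgue. 0 < L2_norm w f \<and> L2_norm w f < top}.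
        N (T f) / L2_norm w f)"

text \<open>A case distinction is needed because division in \<^typ>\<open>ennreal\<close> has \<^prop>\<open>0 / 0 = (0 :: ennreal)\<close>.\<close>

definition quot_top :: "ennreal \<Rightarrow> ennreal \<Rightarrow> ennreal" where
  "quot_top a b = (if b = 0 then top else a / b)"

end

theory Submission
  imports Defs
begin

text \<open>
  Upper bound. For \<open>A\<close> in a finite subfamily of \<open>S\<close> and \<open>G\<close> the set where the corresponding sum exceeds
  \<open>\<lambda>\<close>, put \<open>a\<^sub>A = M\<^sub>A f\<close> and \<open>b\<^sub>A = w(A \<inter> G) / w(A)\<close>. Sparseness and \<open>A\<^sub>2\<close> give
  \<open>w(A) \<le> \<gamma>\<^sup>-\<^sup>2 [w] w(E\<^sub>A)\<close>, hence \<open>\<lambda> w(G) \<le> \<gamma>\<^sup>-\<^sup>2 [w] \<Sum> a\<^sub>A b\<^sub>A w(E\<^sub>A)\<close>. On the index set with masses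
  \<open>w(E\<^sub>A)\<close>, \<open>a\<close> lies in weak \<open>\<ell>\<^sup>2\<close> with squared norm of order \<open>[w] \<parallel>f\<parallel>\<^sup>2\<close> (weak type of the maximal
  function), and \<open>b \<le> 1\<close> lies in weak \<open>\<ell>\<^sup>1\<close> with norm of order \<open>w(G)\<close> (weak type of the maximal function
  with respect to \<open>w\<close>, which in dimension one is free of doubling constants). Lorentz duality bounds
  the sum by a multiple of \<open>([w] \<parallel>f\<parallel>\<^sup>2 w(G))\<^sup>1\<^sup>/\<^sup>2\<close>.

  Sharpness. Take the intervals \<open>[0, 2\<^sup>-\<^sup>k]\<close>, the weight \<open>\<bar>x\<bar>\<^bsup>\<alpha>-1\<^esup>\<close> with \<open>\<alpha> = 1/N\<close>, whose constant is
  comparable to \<open>N\<close>, and \<open>f\<close> the indicator of \<open>[1, 2]\<close>, of norm at most \<open>1\<close>. Every interval has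
  \<open>M\<^sub>A f \<ge> 1/2\<close>, so the operator exceeds \<open>N/2\<close> on \<open>[0, 2\<^sup>-\<^sup>N]\<close>, and this set still has mass \<open>N/2\<close>.
\<close>

subsection \<open>Covering by intervals with bounded overlap\<close>

text \<open>On each side of a common point the three intervals are nested. One member reaches
  furthest left and one furthest right, and together these contain the rest.\<close>

lemma interval_among_three:
  fixes A B C :: "real set"
  assumes "is_interval A" "is_interval B" "is_interval C" "x \<in> A" "x \<in> B" "x \<in> C"
  shows "A \<subseteq> B \<union> C \<or> B \<subseteq> A \<union> C \<or> C \<subseteq> A \<union> B"
proof -
  have left: "U \<inter> {..x} \<subseteq> V \<or> V \<inter> {..x} \<subseteq> U" and right: "U \<inter> {x..} \<subseteq> V \<or> V \<inter> {x..} \<subseteq> U"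
    if "is_interval U" "is_interval V" "x \<in> U" "x \<in> V" for U V :: "real set"
  proof -
    show "U \<inter> {..x} \<subseteq> V \<or> V \<inter> {..x} \<subseteq> U"
    proof (rule ccontr)
      assume "\<not> ?thesis"
      then obtain u v where "u \<in> U" "u \<le> x" "u \<notin> V" "v \<in> V" "v \<le> x" "v \<notin> U" by auto
      with that show False
        unfolding is_interval_1 by (metis linorder_le_cases)
    qed
    show "U \<inter> {x..} \<subseteq> V \<or> V \<inter> {x..} \<subseteq> U"
    proof (rule ccontr)
      assume "\<not> ?thesis"
      then obtain u v where "u \<in> U" "x \<le> u" "u \<notin> V" "v \<in> V" "x \<le> v" "v \<notin> U" by auto
      with that show False
        unfolding is_interval_1 by (metis linorder_le_cases)
    qed
  qed
  have split: "U \<subseteq> V" if "U \<inter> {..x} \<subseteq> V" "U \<inter> {x..} \<subseteq> V" for U V :: "real set"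
  proof
    fix u assume "u \<in> U" with that show "u \<in> V" by (cases "u \<le> x") auto
  qed
  show ?thesis
    using left[of A B] left[of A C] left[of B C] right[of A B] right[of A C] right[of B C] assms
      split[of A "B \<union> C"] split[of B "A \<union> C"] split[of C "A \<union> B"]
    by (smt (verit) Un_iff subset_iff)
qed

text \<open>A subfamily of least cardinality with the full union has no redundant member, whereas
  three members through one point would make one of them redundant. This one-dimensional selection
  replaces the Vitali covering lemma and dilates no interval.\<close>

lemma interval_cover_overlap:
  fixes F :: "real set set"
  assumes "finite F" "\<And>A. A \<in> F \<Longrightarrow> is_interval A"
  obtains F' where "F' \<subseteq> F" "\<Union>F' = \<Union>F" "\<And>x. card {A\<in>F'. x \<in> A} \<le> 2"
proof -
  define P where "P = (\<lambda>H. H \<subseteq> F \<and> \<Union>H = \<Union>F)"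
  obtain H where H: "P H" and min: "\<And>G. P G \<Longrightarrow> card H \<le> card G"
    using ex_has_least_nat[of P F card] unfolding P_def by auto
  have "finite H" using H assms(1) finite_subset unfolding P_def by auto
  have irred: "\<not> A \<subseteq> \<Union>(H - {A})" if "A \<in> H" for A
  proof
    assume "A \<subseteq> \<Union>(H - {A})"
    then have "\<Union>(H - {A}) = \<Union>H" by blast
    then have "P (H - {A})" using H unfolding P_def by auto
    from min[OF this] show False using \<open>finite H\<close> that
      by (metis card_Diff1_less leD)
  qed
  have "card {A\<in>H. x \<in> A} \<le> 2" for x
  proof (rule ccontr)
    assume "\<not> ?thesis"
    then have "3 \<le> card {A\<in>H. x \<in> A}" by simp
    then obtain T where T: "T \<subseteq> {A\<in>H. x \<in> A}" "card T = 3"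
      by (meson obtain_subset_with_card_n)
    then obtain A B C where "T = {A,B,C}" "A \<noteq> B" "A \<noteq> C" "B \<noteq> C"
      by (metis card_3_iff)
    with T have abc: "A \<in> H" "B \<in> H" "C \<in> H" "x \<in> A" "x \<in> B" "x \<in> C" by auto
    moreover have "is_interval A" "is_interval B" "is_interval C"
      using abc H assms(2) unfolding P_def by auto
    ultimately have "A \<subseteq> B \<union> C \<or> B \<subseteq> A \<union> C \<or> C \<subseteq> A \<union> B"
      using interval_among_three by metis
    with irred[of A] irred[of B] irred[of C] abc \<open>A \<noteq> B\<close> \<open>A \<noteq> C\<close> \<open>B \<noteq> C\<close> show False by blast
  qed
  with H that show ?thesis unfolding P_def by blast
qed

lemma intervals_lmeasurable: "A \<in> intervals \<Longrightarrow> A \<in> lmeasurable"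
  unfolding intervals_def using is_interval_convex measurable_convex by blast

lemma intervals_sets: "A \<in> intervals \<Longrightarrow> A \<in> sets lebesgue"
  using intervals_lmeasurable by blast

text \<open>With overlap at most 2, the masses \<open>emeasure N A\<close> of the selected intervals
  add up to at most twice the mass of the line. Both maximal estimates below are instances; nothing
  is dilated, so no doubling constant enters.\<close>

lemma emeasure_Union_intervals_le:
  fixes c :: ennreal
  assumes F: "finite F" "F \<subseteq> intervals"
    and [simp]: "sets M = sets lebesgue" "sets N = sets lebesgue"
    and le: "\<And>A. A \<in> F \<Longrightarrow> emeasure M A \<le> c * emeasure N A"
  shows "emeasure M (\<Union>F) \<le> 2 * c * emeasure N UNIV"
proof -
  obtain H where H: "H \<subseteq> F" "\<Union>H = \<Union>F" "\<And>x. card {A\<in>H. x \<in> A} \<le> 2"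
    using interval_cover_overlap[of F] F unfolding intervals_def by blast
  have fin: "finite H" using H(1) F(1) finite_subset by blast
  have meas: "A \<in> sets lebesgue" if "A \<in> H" for A
    using that H(1) F(2) intervals_sets by blast
  have "emeasure M (\<Union>F) = emeasure M (\<Union>A\<in>H. A)" using H(2) by simp
  also have "\<dots> \<le> (\<Sum>A\<in>H. emeasure M A)"
    using fin meas by (intro emeasure_subadditive_finite) auto
  also have "\<dots> \<le> (\<Sum>A\<in>H. c * emeasure N A)"
    using H(1) le by (intro sum_mono) auto
  also have "\<dots> = c * (\<Sum>A\<in>H. \<integral>\<^sup>+x. indicator A x \<partial>N)"
    using meas by (simp add: sum_distrib_left)
  also have "\<dots> = c * (\<integral>\<^sup>+x. (\<Sum>A\<in>H. indicator A x) \<partial>N)"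
    using meas by (subst nn_integral_sum) (auto intro!: borel_measurable_indicator)
  also have "\<dots> \<le> c * (\<integral>\<^sup>+x. 2 \<partial>N)"
  proof (intro mult_left_mono nn_integral_mono)
    fix x
    have "(\<Sum>A\<in>H. indicator A x :: ennreal) = of_nat (card {A\<in>H. x \<in> A})"
      using fin by (simp add: indicator_def sum.If_cases Int_def)
    also have "\<dots> \<le> of_nat 2" using H(3) of_nat_mono by blast
    finally show "(\<Sum>A\<in>H. indicator A x :: ennreal) \<le> 2" by simp
  qed simp
  also have "\<dots> = 2 * c * emeasure N UNIV"
    using sets_eq_imp_space_eq[of N lebesgue] by (simp add: mult_ac)
  finally show ?thesis .
qed

subsection \<open>Duality of discrete Lorentz spaces\<close>

text \<open>The decreasing rearrangement of \<open>a\<close> at mass t is at most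
  \<open>sqrt (X / t)\<close>, and integrating this up to \<open>sum m H\<close> gives the
  right-hand side. Discretely, indices are added in decreasing order of \<open>a\<close>, so the
  superlevel set of the new index is everything so far.\<close>

lemma sum_le_sqrt_of_weak_type:
  fixes a m :: "'b \<Rightarrow> real"
  assumes "finite H" "\<And>i. i \<in> H \<Longrightarrow> 0 \<le> a i" "\<And>i. i \<in> H \<Longrightarrow> 0 < m i" "0 \<le> X"
    and "\<And>i. i \<in> H \<Longrightarrow> (a i)\<^sup>2 * (\<Sum>j\<in>{j\<in>H. a i \<le> a j}. m j) \<le> X"
  shows "(\<Sum>i\<in>H. a i * m i) \<le> 2 * sqrt (X * sum m H)"
  using assms
proof (induction H rule: finite_ranking_induct[where f = "\<lambda>i. - a i"])
  case empty then show ?case by simp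
next
  case (insert i H)
  show ?case
  proof (cases "i \<in> H")
    case True
    with insert show ?thesis by (simp add: insert_absorb)
  next
    case False
    let ?M = "sum m H"
    have M: "0 \<le> ?M" using insert.prems(2) by (intro sum_nonneg) (simp add: less_imp_le)
    have mi: "0 < m i" and ai: "0 \<le> a i" using insert.prems by auto
    have "(\<Sum>j\<in>H. a j * m j) \<le> 2 * sqrt (X * ?M)"
    proof (rule insert.IH)
      fix j assume j: "j \<in> H"
      have "(\<Sum>k\<in>{k\<in>H. a j \<le> a k}. m k) \<le> (\<Sum>k\<in>{k\<in>insert i H. a j \<le> a k}. m k)"
        using insert by (intro sum_mono2) (auto simp: less_imp_le)
      then show "(a j)\<^sup>2 * (\<Sum>k\<in>{k\<in>H. a j \<le> a k}. m k) \<le> X"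
        using insert.prems(4)[of j] j by (smt (verit) insertI2 mult_left_mono zero_le_power2)
    qed (use insert.prems in auto)
    moreover have "{k\<in>insert i H. a i \<le> a k} = insert i H" using insert.hyps by auto
    then have "(a i)\<^sup>2 * (m i + ?M) \<le> X"
      using insert.prems(4)[of i] insert.hyps False by simp
    then have "sqrt ((a i)\<^sup>2 * (m i + ?M)) \<le> sqrt X" by simp
    then have *: "a i * sqrt (m i + ?M) \<le> sqrt X" using ai by (simp add: real_sqrt_mult)
    \<comment> \<open>The right-hand side is the increment of \<open>2 * sqrt (X * t)\<close> as t
      grows from \<open>?M\<close> to \<open>m i + ?M\<close>, so it telescopes with the induction
      hypothesis.\<close>
    have "a i * m i \<le> 2 * sqrt X * (sqrt (m i + ?M) - sqrt ?M)"
    proof -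
      let ?s = "sqrt (m i + ?M)" and ?t = "sqrt ?M"
      have st: "?t \<le> ?s" "0 \<le> ?t" "m i = (?s - ?t) * (?s + ?t)"
        using mi M by (auto simp: algebra_simps)
      have "a i * m i = (?s - ?t) * (a i * (?s + ?t))" using st(3) by (simp add: mult_ac)
      also have "\<dots> \<le> (?s - ?t) * (2 * (a i * ?s))"
        using st ai by (intro mult_left_mono) (auto simp: mult_left_mono algebra_simps)
      also have "\<dots> \<le> (?s - ?t) * (2 * sqrt X)"
        using * st by (intro mult_left_mono) auto
      finally show ?thesis by (simp add: mult_ac)
    qed
    ultimately have "(\<Sum>j\<in>insert i H. a j * m j) \<le> 2 * (sqrt X * sqrt (m i + ?M))"
      using insert.hyps False by (simp add: real_sqrt_mult algebra_simps)
    then show ?thesis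
      using insert.hyps False by (simp add: real_sqrt_mult)
  qed
qed

text \<open>The parameter \<open>\<beta>\<close> carries the Abel summation along the decreasing values of \<open>b\<close>.\<close>

lemma sum_prod_le_of_weak_types_aux:
  fixes a b m :: "'b \<Rightarrow> real"
  assumes "finite H" "\<And>i. i \<in> H \<Longrightarrow> 0 \<le> a i" "\<And>i. i \<in> H \<Longrightarrow> 0 < m i" "0 \<le> X" "0 \<le> Y"
    and "\<And>i. i \<in> H \<Longrightarrow> (a i)\<^sup>2 * (\<Sum>j\<in>{j\<in>H. a i \<le> a j}. m j) \<le> X"
    and "\<And>i. i \<in> H \<Longrightarrow> b i * (\<Sum>j\<in>{j\<in>H. b i \<le> b j}. m j) \<le> Y"
    and "\<And>i. i \<in> H \<Longrightarrow> \<beta> \<le> b i" "\<And>i. i \<in> H \<Longrightarrow> b i \<le> 1" "0 \<le> \<beta>" "\<beta> \<le> 1"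
  shows "(\<Sum>i\<in>H. (b i - \<beta>) * (a i * m i)) \<le> 4 * sqrt (X * Y) * (1 - sqrt \<beta>)"
  using assms
proof (induction H arbitrary: \<beta> rule: finite_ranking_induct[where f = "\<lambda>i. - b i"])
  case empty then show ?case by simp
next
  case (insert i H)
  show ?case
  proof (cases "i \<in> H")
    case True
    with insert show ?thesis by (simp add: insert_absorb)
  next
    case False
    have mono: "sum m {k\<in>H. P k} \<le> sum m {k\<in>insert i H. P k}" for P
      using insert by (intro sum_mono2) (auto simp: less_imp_le)
    \<comment> \<open>The inserted index has the least value of \<open>b\<close>, so the induction
      hypothesis applies with \<open>b i\<close> in place of \<open>\<beta>\<close>.\<close>
    have IH: "(\<Sum>j\<in>H. (b j - b i) * (a j * m j)) \<le> 4 * sqrt (X * Y) * (1 - sqrt (b i))"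
    proof (rule insert.IH)
      fix j assume j: "j \<in> H"
      show "(a j)\<^sup>2 * (\<Sum>k\<in>{k\<in>H. a j \<le> a k}. m k) \<le> X"
        using insert.prems(5)[of j] j mono[of "\<lambda>k. a j \<le> a k"]
        by (smt (verit) insertI2 mult_left_mono zero_le_power2)
      have "0 \<le> b j" using insert.prems(7)[of j] insert.prems(9) j by simp
      with insert.prems(6)[of j] j mono[of "\<lambda>k. b j \<le> b k"]
      show "b j * (\<Sum>k\<in>{k\<in>H. b j \<le> b k}. m k) \<le> Y"
        by (smt (verit) insertI2 mult_left_mono)
      show "b i \<le> b j" using insert.hyps j by auto
    qed (use insert.prems in \<open>auto intro: order_trans\<close>)
    let ?H = "insert i H"
    let ?M = "sum m ?H"
    have M: "0 \<le> ?M" using insert.prems(2) by (intro sum_nonneg) (simp add: less_imp_le)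
    have "{k\<in>?H. b i \<le> b k} = ?H" using insert.hyps by auto
    then have bM: "b i * ?M \<le> Y" using insert.prems(6)[of i] by simp
    have bi: "\<beta> \<le> b i" "0 \<le> b i" using insert.prems(7)[of i] insert.prems(9) by auto
    \<comment> \<open>The difference \<open>b i - \<beta>\<close> is common to all indices of
      \<open>?H\<close> and multiplies the plain sum of \<open>a * m\<close>; the
      \<open>sqrt ?M\<close> arising here is absorbed by \<open>bM\<close>.\<close>
    have K: "(\<Sum>i\<in>?H. a i * m i) \<le> 2 * sqrt (X * ?M)"
      using insert.prems insert.hyps(1) by (intro sum_le_sqrt_of_weak_type) auto
    let ?s = "sqrt (b i)" and ?t = "sqrt \<beta>"
    have st: "?t \<le> ?s" "0 \<le> ?t" "b i - \<beta> = (?s - ?t) * (?s + ?t)"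
      using bi insert.prems(9) by (auto simp: algebra_simps)
    have "(b i - \<beta>) * (\<Sum>i\<in>?H. a i * m i) \<le> (b i - \<beta>) * (2 * sqrt (X * ?M))"
      using K bi by (intro mult_left_mono) auto
    also have "\<dots> \<le> (?s - ?t) * (2 * ?s) * (2 * sqrt (X * ?M))"
      unfolding st(3) using st M insert.prems(3) by (intro mult_right_mono mult_left_mono) auto
    also have "\<dots> = 4 * (?s - ?t) * sqrt (X * (b i * ?M))"
      by (simp add: real_sqrt_mult)
    also have "\<dots> \<le> 4 * (?s - ?t) * sqrt (X * Y)"
      using st bM insert.prems(3) by (intro mult_left_mono) (auto simp: mult_left_mono)
    finally have 1: "(b i - \<beta>) * (\<Sum>i\<in>?H. a i * m i) \<le> 4 * (?s - ?t) * sqrt (X * Y)" .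
    have "(\<Sum>j\<in>?H. (b j - \<beta>) * (a j * m j))
        = (\<Sum>j\<in>?H. (b j - b i) * (a j * m j)) + (b i - \<beta>) * (\<Sum>j\<in>?H. a j * m j)"
      by (simp add: sum_distrib_left flip: sum.distrib) (simp add: algebra_simps)
    also have "(\<Sum>j\<in>?H. (b j - b i) * (a j * m j)) = (\<Sum>j\<in>H. (b j - b i) * (a j * m j))"
      using False insert.hyps by simp
    finally show ?thesis using IH 1 by (simp add: algebra_simps)
  qed
qed

text \<open>The constant is that of the continuous model: the rearrangements are at most
  \<open>sqrt (X / t)\<close> and \<open>min 1 (Y / t)\<close>, and the integral of their product
  over t > 0 is \<open>4 * sqrt (X * Y)\<close>.\<close>

lemma sum_prod_le_of_weak_types:
  fixes a b m :: "'b \<Rightarrow> real"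
  assumes "finite H" "\<And>i. i \<in> H \<Longrightarrow> 0 \<le> a i" "\<And>i. i \<in> H \<Longrightarrow> 0 < m i" "0 \<le> X" "0 \<le> Y"
    and "\<And>i. i \<in> H \<Longrightarrow> (a i)\<^sup>2 * (\<Sum>j\<in>{j\<in>H. a i \<le> a j}. m j) \<le> X"
    and "\<And>i. i \<in> H \<Longrightarrow> b i * (\<Sum>j\<in>{j\<in>H. b i \<le> b j}. m j) \<le> Y"
    and "\<And>i. i \<in> H \<Longrightarrow> 0 \<le> b i" "\<And>i. i \<in> H \<Longrightarrow> b i \<le> 1"
  shows "(\<Sum>i\<in>H. a i * b i * m i) \<le> 4 * sqrt (X * Y)"
  using sum_prod_le_of_weak_types_aux[of H a m X Y b 0] assms by (simp add: mult_ac)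

subsection \<open>Weighted estimates\<close>

abbreviation wmeas :: "(real \<Rightarrow> real) \<Rightarrow> real measure" where
  "wmeas g \<equiv> density lebesgue (\<lambda>x. ennreal (g x))"

lemma emeasure_wmeas:
  "g \<in> borel_measurable lebesgue \<Longrightarrow> A \<in> sets lebesgue \<Longrightarrow>
    emeasure (wmeas g) A = (\<integral>\<^sup>+x\<in>A. ennreal (g x) \<partial>lebesgue)"
  by (simp add: emeasure_density)

lemma emeasure_wmeas_pos:
  assumes "g \<in> borel_measurable lebesgue" "\<And>x. 0 < g x"
    and "A \<in> sets lebesgue" "emeasure lebesgue A > 0"
  shows "emeasure (wmeas g) A > 0"
proof (rule ccontr)
  assume "\<not> ?thesis"
  then have "(\<integral>\<^sup>+x\<in>A. ennreal (g x) \<partial>lebesgue) = 0"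
    using assms by (simp add: emeasure_wmeas)
  then have "AE x in lebesgue. ennreal (g x) * indicator A x = 0"
    using assms by (subst (asm) nn_integral_0_iff_AE) auto
  then have "AE x in lebesgue. x \<notin> A"
  proof eventually_elim
    case (elim x)
    have "ennreal (g x) \<noteq> 0" using assms(2)[of x] by (simp add: ennreal_eq_0_iff)
    with elim show ?case by (auto simp: indicator_def split: if_splits)
  qed
  then have "emeasure lebesgue A = 0"
    using assms(3) by (subst (asm) AE_iff_measurable[where N = A]) auto
  with assms(4) show False by simp
qed

lemma intervals_emeasure:
  assumes "A \<in> intervals"
  shows "0 < emeasure lebesgue A" "emeasure lebesgue A < top"
  using assms intervals_lmeasurable[OF assms] by (auto simp: intervals_def fmeasurable_def)

lemma avg_A2_le:
  assumes "A \<in> intervals"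
  shows "avg A w * avg A (\<lambda>x. inverse (w x)) \<le> A2_char w"
  unfolding A2_char_def using assms by (rule SUP_upper)

lemma avg_eq_wmeas:
  assumes "g \<in> borel_measurable lebesgue" "\<And>x. 0 < g x" "A \<in> sets lebesgue"
  shows "avg A g = emeasure (wmeas g) A / emeasure lebesgue A"
  unfolding avg_def using assms by (simp add: emeasure_wmeas abs_of_pos)

text \<open>Since \<open>0 * top = 0\<close>, a finite product of averages bounds the first factor
  only if the second is nonzero; this follows from positivity of the reciprocal weight.\<close>

lemma A2_weight_emeasure_finite:
  assumes "A2_weight w" "A \<in> intervals"
  shows "emeasure (wmeas w) A < top"
proof -
  have w: "w \<in> borel_measurable lebesgue" "\<And>x. 0 < w x" "A2_char w < top"
    using assms(1) by (auto simp: A2_weight_def weight_def)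
  have iw: "(\<lambda>x. inverse (w x)) \<in> borel_measurable lebesgue" "\<And>x. 0 < inverse (w x)"
    using w by auto
  note A = intervals_sets[OF assms(2)] intervals_emeasure[OF assms(2)]
  have "avg A w * avg A (\<lambda>x. inverse (w x)) < top"
    using avg_A2_le[OF assms(2)] w(3) by (rule le_less_trans)
  moreover have "avg A (\<lambda>x. inverse (w x)) \<noteq> 0"
    using emeasure_wmeas_pos[OF iw A(1,2)] A
    by (auto simp: avg_eq_wmeas[OF iw A(1)] ennreal_divide_eq_0_iff simp del: emeasure_completion)
  ultimately have "avg A w \<noteq> top" by (auto simp: ennreal_mult_eq_top_iff)
  then show ?thesis
    using A by (auto simp: avg_eq_wmeas[OF w(1,2)] ennreal_divide_eq_top_iff less_top)
qed

lemma Cauchy_Schwarz_weight: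
  assumes "weight w" and [measurable]: "f \<in> borel_measurable lebesgue" "A \<in> sets lebesgue"
  shows "(\<integral>\<^sup>+x\<in>A. ennreal \<bar>f x\<bar> \<partial>lebesgue)\<^sup>2
    \<le> (\<integral>\<^sup>+x\<in>A. ennreal (\<bar>f x\<bar>\<^sup>2 * w x) \<partial>lebesgue) * (\<integral>\<^sup>+x\<in>A. ennreal (inverse (w x)) \<partial>lebesgue)"
proof -
  have [measurable]: "w \<in> borel_measurable lebesgue" and pos: "\<And>x. 0 < w x"
    using assms(1) by (auto simp: weight_def)
  let ?u = "\<lambda>x. ennreal (\<bar>f x\<bar> * sqrt (w x)) * indicator A x"
  let ?v = "\<lambda>x. ennreal (sqrt (inverse (w x))) * indicator A x"
  have "?u x * ?v x = ennreal \<bar>f x\<bar> * indicator A x" for x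
    using pos[of x] by (auto simp: indicator_def real_sqrt_inverse simp flip: ennreal_mult)
  moreover have "(?u x)\<^sup>2 = ennreal (\<bar>f x\<bar>\<^sup>2 * w x) * indicator A x" for x
    using pos[of x] by (auto simp: indicator_def ennreal_power power_mult_distrib)
  moreover have "(?v x)\<^sup>2 = ennreal (inverse (w x)) * indicator A x" for x
    using pos[of x] by (auto simp: indicator_def ennreal_power)
  moreover have "(\<integral>\<^sup>+x. ?u x * ?v x \<partial>lebesgue)\<^sup>2 \<le> (\<integral>\<^sup>+x. (?u x)\<^sup>2 \<partial>lebesgue) * (\<integral>\<^sup>+x. (?v x)\<^sup>2 \<partial>lebesgue)"
    by (intro Cauchy_Schwarz_nn_integral) measurable
  ultimately show ?thesis by simp
qed

text \<open>Cauchy-Schwarz produces the integral of the reciprocal weight, which together with the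
  weight of \<open>A\<close> over its squared length forms the A2 product. The comparison with
  sparse subsets and the maximal estimate both use the A2 condition in this form.\<close>

lemma avg_sq_weight_le:
  assumes "weight w" "f \<in> borel_measurable lebesgue" "A \<in> intervals"
  shows "(avg A f)\<^sup>2 * emeasure (wmeas w) A \<le> A2_char w * (\<integral>\<^sup>+x\<in>A. ennreal (\<bar>f x\<bar>\<^sup>2 * w x) \<partial>lebesgue)"
proof -
  have w: "w \<in> borel_measurable lebesgue" "\<And>x. 0 < w x"
    using assms(1) by (auto simp: weight_def)
  have A: "A \<in> sets lebesgue" using assms(3) by (rule intervals_sets)
  let ?I = "\<integral>\<^sup>+x\<in>A. ennreal (\<bar>f x\<bar>\<^sup>2 * w x) \<partial>lebesgue"
  let ?L = "emeasure lebesgue A"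
  have "(avg A f)\<^sup>2 * emeasure (wmeas w) A
      = (\<integral>\<^sup>+x\<in>A. ennreal \<bar>f x\<bar> \<partial>lebesgue)\<^sup>2 * (inverse ?L * inverse ?L * emeasure (wmeas w) A)"
    by (simp add: avg_def divide_ennreal_def power2_eq_square mult_ac)
  also have "\<dots> \<le> (?I * (\<integral>\<^sup>+x\<in>A. ennreal (inverse (w x)) \<partial>lebesgue)) * (inverse ?L * inverse ?L * emeasure (wmeas w) A)"
    using Cauchy_Schwarz_weight[OF assms(1,2) A] by (rule mult_right_mono) simp
  also have "\<dots> = ?I * (avg A w * avg A (\<lambda>x. inverse (w x)))"
    using w A by (simp add: avg_def emeasure_wmeas divide_ennreal_def mult_ac abs_of_pos)
  also have "\<dots> \<le> ?I * A2_char w"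
    using avg_A2_le[OF assms(3)] by (rule mult_left_mono) simp
  finally show ?thesis by (simp add: mult.commute)
qed

text \<open>This is the previous estimate tested on the indicator of \<open>E\<close>, whose average
  over \<open>A\<close> is at least \<open>\<gamma>\<close>.\<close>

lemma A2_sparse_subset:
  assumes "weight w" "A \<in> intervals" "E \<in> sets lebesgue" "E \<subseteq> A"
    and "ennreal \<gamma> * emeasure lebesgue A \<le> emeasure lebesgue E"
  shows "(ennreal \<gamma>)\<^sup>2 * emeasure (wmeas w) A \<le> A2_char w * emeasure (wmeas w) E"
proof -
  let ?f = "indicat_real E"
  note L = intervals_emeasure[OF assms(2)]
  have w: "w \<in> borel_measurable lebesgue" using assms(1) by (auto simp: weight_def)
  have "ennreal \<bar>?f x\<bar> * indicator A x = indicator E x" for x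
    using assms(4) by (auto simp: indicator_def)
  then have "avg A ?f = emeasure lebesgue E / emeasure lebesgue A"
    using assms(3) by (simp add: avg_def)
  moreover have "ennreal \<gamma> = ennreal \<gamma> * emeasure lebesgue A / emeasure lebesgue A"
    using L by (simp add: ennreal_mult_divide_eq)
  ultimately have "ennreal \<gamma> \<le> avg A ?f"
    using assms(5) by (metis divide_right_mono_ennreal)
  then have "(ennreal \<gamma>)\<^sup>2 * emeasure (wmeas w) A \<le> (avg A ?f)\<^sup>2 * emeasure (wmeas w) A"
    by (intro mult_right_mono power_mono) auto
  also have "\<dots> \<le> A2_char w * (\<integral>\<^sup>+x\<in>A. ennreal (\<bar>?f x\<bar>\<^sup>2 * w x) \<partial>lebesgue)"
    using assms by (intro avg_sq_weight_le) auto
  also have "(\<integral>\<^sup>+x\<in>A. ennreal (\<bar>?f x\<bar>\<^sup>2 * w x) \<partial>lebesgue) = emeasure (wmeas w) E"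
    using assms(3,4) w by (subst emeasure_wmeas) (auto intro!: nn_integral_cong simp: indicator_def)
  finally show ?thesis .
qed

lemma ennreal_le_divide_mult:
  fixes x y z :: ennreal
  assumes "x * y \<le> z" "x \<noteq> 0" "x \<noteq> top"
  shows "y \<le> z / x"
proof -
  have "y = x * y / x"
    using assms by (metis ennreal_mult_divide_eq mult.commute)
  also have "\<dots> \<le> z / x" using assms(1) by (rule divide_right_mono_ennreal)
  finally show ?thesis .
qed

section \<open>Weak-type estimates for maximal averages and weighted densities\<close>

text \<open>Every \<open>A\<close> lies in an interval \<open>c A\<close> over which
  \<open>f\<close> has average above \<open>s\<close>, and \<open>avg_sq_weight_le\<close> bounds
  the weight of \<open>c A\<close>. The covering argument is run on these larger intervals against
  the measure with density \<open>\<bar>f x\<bar>\<^sup>2 * w x\<close>.\<close>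

lemma max_avg_weak_type:
  assumes "weight w" and f[measurable]: "f \<in> borel_measurable lebesgue"
    and F: "finite F" "F \<subseteq> intervals" and s: "0 < s" "\<And>A. A \<in> F \<Longrightarrow> ennreal s < max_avg A f"
  shows "(ennreal s)\<^sup>2 * emeasure (wmeas w) (\<Union>F)
    \<le> 2 * A2_char w * (\<integral>\<^sup>+x. ennreal (\<bar>f x\<bar>\<^sup>2 * w x) \<partial>lebesgue)"
proof -
  have w[measurable]: "w \<in> borel_measurable lebesgue" using assms(1) by (auto simp: weight_def)
  have "\<forall>A\<in>F. \<exists>B. B \<in> intervals \<and> A \<subseteq> B \<and> ennreal s < avg B f"
    using s(2) unfolding max_avg_def less_SUP_iff by blast
  then obtain c where c: "\<And>A. A \<in> F \<Longrightarrow> c A \<in> intervals \<and> A \<subseteq> c A \<and> ennreal s < avg (c A) f"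
    by metis
  let ?N = "density lebesgue (\<lambda>x. ennreal (\<bar>f x\<bar>\<^sup>2 * w x))"
  let ?s = "(ennreal s)\<^sup>2"
  have s0: "?s \<noteq> 0" "?s \<noteq> top" using s(1) by (auto simp: ennreal_power)
  have cF: "\<Union>(c ` F) \<in> sets lebesgue"
    using F c intervals_sets by (intro sets.finite_Union) auto
  have "emeasure (wmeas w) (\<Union>F) \<le> emeasure (wmeas w) (\<Union>(c ` F))"
    using c cF by (intro emeasure_mono) auto
  also have "\<dots> \<le> 2 * (A2_char w / ?s) * emeasure ?N UNIV"
  proof (rule emeasure_Union_intervals_le)
    fix B assume "B \<in> c ` F"
    then have B: "B \<in> intervals" "ennreal s \<le> avg B f" using c by (auto intro: less_imp_le)
    have "?s * emeasure (wmeas w) B \<le> (avg B f)\<^sup>2 * emeasure (wmeas w) B"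
      using B by (intro mult_right_mono power_mono) auto
    also have "\<dots> \<le> A2_char w * emeasure ?N B"
      using avg_sq_weight_le[OF assms(1) f B(1)] intervals_sets[OF B(1)]
      by (subst emeasure_density) auto
    finally have "emeasure (wmeas w) B \<le> A2_char w * emeasure ?N B / ?s"
      using s0 by (rule ennreal_le_divide_mult)
    then show "emeasure (wmeas w) B \<le> A2_char w / ?s * emeasure ?N B"
      by (simp add: divide_ennreal_def mult_ac)
  qed (use F c in auto)
  finally have "?s * emeasure (wmeas w) (\<Union>F) \<le> ?s * (2 * (A2_char w / ?s) * emeasure ?N UNIV)"
    by (rule mult_left_mono) simp
  also have "\<dots> = (?s / ?s) * (2 * A2_char w * emeasure ?N UNIV)"
    by (simp add: divide_ennreal_def mult_ac)
  also have "?s / ?s = 1" using s0 by (intro ennreal_divide_self) (auto simp: less_top)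
  also have "emeasure ?N UNIV = (\<integral>\<^sup>+x. ennreal (\<bar>f x\<bar>\<^sup>2 * w x) \<partial>lebesgue)"
    by (subst emeasure_density) auto
  finally show ?thesis by simp
qed

text \<open>Weak type (1,1) of the maximal function taken with respect to \<open>w\<close> itself,
  applied to the indicator of \<open>G\<close>. Averages and measure use the same weight, so
  \<open>A2_char\<close> does not enter.\<close>

lemma weighted_density_weak_type:
  assumes "weight w" and G[measurable]: "G \<in> sets lebesgue"
    and F: "finite F" "F \<subseteq> intervals" and t: "0 < t"
    "\<And>A. A \<in> F \<Longrightarrow> ennreal t * emeasure (wmeas w) A \<le> emeasure (wmeas w) (A \<inter> G)"
  shows "ennreal t * emeasure (wmeas w) (\<Union>F) \<le> 2 * emeasure (wmeas w) G"
proof -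
  have w[measurable]: "w \<in> borel_measurable lebesgue" using assms(1) by (auto simp: weight_def)
  let ?N = "density lebesgue (\<lambda>x. ennreal (w x) * indicator G x)"
  let ?t = "ennreal t"
  have t0: "?t \<noteq> 0" "?t \<noteq> top" using t(1) by auto
  have N: "emeasure ?N B = emeasure (wmeas w) (B \<inter> G)" if [measurable]: "B \<in> sets lebesgue" for B
    by (auto simp: emeasure_density indicator_def intro!: nn_integral_cong)
  have "emeasure (wmeas w) (\<Union>F) \<le> 2 * (1 / ?t) * emeasure ?N UNIV"
  proof (rule emeasure_Union_intervals_le)
    fix B assume B: "B \<in> F"
    then have "emeasure (wmeas w) B \<le> emeasure (wmeas w) (B \<inter> G) / ?t"
      using t(2) t0 by (intro ennreal_le_divide_mult) auto
    also have "emeasure (wmeas w) (B \<inter> G) = emeasure ?N B"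
      using B F(2) intervals_sets by (subst N) auto
    finally show "emeasure (wmeas w) B \<le> 1 / ?t * emeasure ?N B"
      by (simp add: divide_ennreal_def mult_ac)
  qed (use F in auto)
  then have "?t * emeasure (wmeas w) (\<Union>F) \<le> ?t * (2 * (1 / ?t) * emeasure ?N UNIV)"
    by (rule mult_left_mono) simp
  also have "\<dots> = (?t / ?t) * (2 * emeasure ?N UNIV)"
    by (simp add: divide_ennreal_def mult_ac)
  also have "?t / ?t = 1" using t0 by (intro ennreal_divide_self) (auto simp: less_top)
  also have "emeasure ?N UNIV = emeasure (wmeas w) G" by (subst N) auto
  finally show ?thesis by simp
qed

text \<open>On the index set with masses \<open>measure M (E A)\<close>, superlevel sets are thereby
  controlled by unions of intervals, for which the covering estimates are available.\<close>

lemma sum_sparse_le_Union: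
  assumes "disjoint_family_on E S" "H \<subseteq> S" "finite H" "sets M = sets lebesgue"
    and "\<And>A. A \<in> S \<Longrightarrow> E A \<in> sets lebesgue \<and> E A \<subseteq> A" "\<And>A. A \<in> H \<Longrightarrow> A \<in> sets lebesgue"
    and "\<And>A. A \<in> H \<Longrightarrow> emeasure M A < top"
  shows "(\<Sum>A\<in>H. measure M (E A)) \<le> measure M (\<Union>H)"
proof -
  have fin: "\<Union>H \<in> fmeasurable M"
    using assms by (intro fmeasurable.finite_Union fmeasurableI subsetI) auto
  have E: "E A \<in> fmeasurable M" if "A \<in> H" for A
  proof (rule fmeasurableI2)
    show "A \<in> fmeasurable M" using assms that by (intro fmeasurableI) auto
  qed (use assms that in auto)
  have "(\<Sum>A\<in>H. measure M (E A)) = measure M (\<Union>A\<in>H. E A)"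
    using assms E fmeasurableD2[OF E] by (intro measure_finite_Union[symmetric])
      (auto intro: disjoint_family_on_mono)
  also have "(\<Union>A\<in>H. E A) \<subseteq> \<Union>H" using assms by blast
  then have "measure M (\<Union>A\<in>H. E A) \<le> measure M (\<Union>H)"
    using assms(3) fin fmeasurableD[OF E] by (intro measure_mono_fmeasurable sets.finite_UN) auto
  finally show ?thesis .
qed

text \<open>An infinite value would make the weak-type bound for the single interval
  \<open>A\<close> hold at every level, although its left-hand side grows without bound.\<close>

lemma max_avg_finite:
  assumes w: "A2_weight w" and f: "f \<in> borel_measurable lebesgue"
    and n: "(\<integral>\<^sup>+x. ennreal (\<bar>f x\<bar>\<^sup>2 * w x) \<partial>lebesgue) < top" and A: "A \<in> intervals"
  shows "max_avg A f < top"
proof (rule ccontr)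
  assume "\<not> ?thesis"
  then have top: "max_avg A f = top" by (metis top.not_eq_extremum)
  let ?K = "2 * A2_char w * (\<integral>\<^sup>+x. ennreal (\<bar>f x\<bar>\<^sup>2 * w x) \<partial>lebesgue)"
  have "?K < top" using w n by (auto simp: A2_weight_def ennreal_mult_less_top)
  then obtain k where k: "?K = ennreal k" "0 \<le> k" by (cases ?K) auto
  have W: "0 < emeasure (wmeas w) A" "emeasure (wmeas w) A < top"
    using w A A2_weight_emeasure_finite emeasure_wmeas_pos[of w A] intervals_sets intervals_emeasure
    by (auto simp: A2_weight_def weight_def)
  then obtain v where v: "emeasure (wmeas w) A = ennreal v" "0 < v"
    by (cases "emeasure (wmeas w) A") auto
  \<comment> \<open>At this level \<open>s \<ge> 1\<close>, hence
    \<open>s\<^sup>2 * v \<ge> s * v = k + v\<close>, which exceeds the bound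
    \<open>k\<close>.\<close>
  define s where "s = k / v + 1"
  have s: "1 \<le> s" using k v by (simp add: s_def)
  have "(ennreal s)\<^sup>2 * emeasure (wmeas w) (\<Union>{A}) \<le> ?K"
    using w f A s top by (intro max_avg_weak_type) (auto simp: A2_weight_def)
  then have "s\<^sup>2 * v \<le> k"
    using k v s by (simp add: ennreal_power flip: ennreal_mult)
  moreover have "s * v \<le> s\<^sup>2 * v"
    using s v by (intro mult_right_mono) (auto simp: power2_eq_square)
  moreover have "s * v = k + v" using v by (simp add: s_def field_simps)
  ultimately show False using v by simp
qed

section \<open>Level-set estimate for finite sparse families\<close>

text \<open>The exponent 3/2 splits as 1 + 1/2: one factor \<open>Q\<close> is the price of
  replacing the weight of \<open>A\<close> by that of \<open>E A\<close>, and \<open>sqrt Q\<close>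
  comes from the weak type of \<open>max_avg\<close>. Finiteness of \<open>F\<close> gives
  \<open>G\<close> finite mass, so that \<open>sqrt g\<close> can be cancelled at the end.\<close>

lemma finite_sparse_sum_weak_type:
  fixes f w :: "real \<Rightarrow> real"
  assumes w: "A2_weight w" and f[measurable]: "f \<in> borel_measurable lebesgue"
    and n: "(\<integral>\<^sup>+x. ennreal (\<bar>f x\<bar>\<^sup>2 * w x) \<partial>lebesgue) = ennreal n" "0 \<le> n"
    and F: "finite F" "F \<subseteq> intervals" and l: "0 < l"
    and \<gamma>: "0 < \<gamma>" and E: "disjoint_family_on E F"
      "\<And>A. A \<in> F \<Longrightarrow> E A \<in> sets lebesgue \<and> E A \<subseteq> A \<and> ennreal \<gamma> * emeasure lebesgue A \<le> emeasure lebesgue (E A)"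
    and G: "G = {x. ennreal l < (\<Sum>A\<in>F. max_avg A f * indicator A x)}"
    and Q: "A2_char w = ennreal Q" "0 \<le> Q"
  shows "emeasure (wmeas w) G \<le> ennreal ((16 / \<gamma>\<^sup>2 * Q powr (3/2) * sqrt n / l)\<^sup>2)"
proof -
  let ?W = "wmeas w"
  have weight: "weight w" and wm[measurable]: "w \<in> borel_measurable lebesgue" and pos: "\<And>x. 0 < w x"
    using w by (auto simp: A2_weight_def weight_def)
  have Am[measurable]: "A \<in> sets lebesgue" if "A \<in> F" for A using that F intervals_sets by blast
  have Wfin: "emeasure ?W A < top" if "A \<in> F" for A
    using that F A2_weight_emeasure_finite[OF w] by blast
  have Gm[measurable]: "G \<in> sets lebesgue"
  proof -
    have "(\<lambda>x. \<Sum>A\<in>F. max_avg A f * indicator A x) \<in> borel_measurable lebesgue"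
      by (intro borel_measurable_sum borel_measurable_times_ennreal borel_measurable_indicator) auto
    then have "{x\<in>space lebesgue. ennreal l < (\<Sum>A\<in>F. max_avg A f * indicator A x)} \<in> sets lebesgue"
      by measurable
    then show ?thesis by (simp add: G)
  qed
  have UF: "\<Union>H \<in> fmeasurable ?W" if "H \<subseteq> F" for H
    using that F(1) finite_subset[of H F] Am Wfin
    by (intro fmeasurable.finite_Union fmeasurableI subsetI) auto
  have eU: "emeasure ?W (\<Union>H) = ennreal (measure ?W (\<Union>H))" if "H \<subseteq> F" for H
    using UF[OF that] by (rule emeasure_eq_measure2)
  have "G \<subseteq> \<Union>F"
  proof
    fix x assume "x \<in> G"
    then have "(\<Sum>A\<in>F. max_avg A f * indicator A x) \<noteq> 0" by (auto simp: G)
    then obtain A where "A \<in> F" "max_avg A f * indicator A x \<noteq> 0" by (meson sum.neutral)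
    then show "x \<in> \<Union>F" by (auto simp: indicator_def split: if_splits)
  qed
  then have Gf: "G \<in> fmeasurable ?W" using UF[of F] Gm by (auto intro: fmeasurableI2[of "\<Union>F" ?W G])
  define g where "g = measure ?W G"
  have eG: "emeasure ?W G = ennreal g" "0 \<le> g"
    using Gf unfolding g_def by (auto intro: emeasure_eq_measure2)
  define a where "a = (\<lambda>A. enn2real (max_avg A f))"
  have a: "max_avg A f = ennreal (a A)" "0 \<le> a A" if "A \<in> F" for A
    using max_avg_finite[OF w f _, of A] that F n(1) by (auto simp: a_def)
  define v where "v = (\<lambda>A. measure ?W A)"
  have v: "emeasure ?W A = ennreal (v A)" "0 < v A" if "A \<in> F" for A
  proof -
    show 1: "emeasure ?W A = ennreal (v A)"
      using Wfin[OF that] unfolding v_def by (intro emeasure_eq_ennreal_measure) auto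
    have "0 < emeasure ?W A"
      using that F by (intro emeasure_wmeas_pos wm pos Am intervals_emeasure(1)) auto
    with 1 show "0 < v A" by simp
  qed
  define u where "u = (\<lambda>A. measure ?W (A \<inter> G))"
  have u: "emeasure ?W (A \<inter> G) = ennreal (u A)" "0 \<le> u A" "u A \<le> v A" if "A \<in> F" for A
  proof -
    have A: "A \<in> fmeasurable ?W" using Am[OF that] Wfin[OF that] by (intro fmeasurableI) auto
    then have "A \<inter> G \<in> fmeasurable ?W" using Gm Am[OF that] by (auto intro: fmeasurableI2[of A ?W "A \<inter> G"])
    then show "emeasure ?W (A \<inter> G) = ennreal (u A)" unfolding u_def by (rule emeasure_eq_measure2)
    show "0 \<le> u A" by (simp add: u_def)
    show "u A \<le> v A" unfolding u_def v_def
      using A Gm Am[OF that] by (intro measure_mono_fmeasurable) auto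
  qed
  define m where "m = (\<lambda>A. measure ?W (E A))"
  have vm: "\<gamma>\<^sup>2 * v A \<le> Q * m A" if "A \<in> F" for A
  proof -
    have "A \<in> fmeasurable ?W" using Am[OF that] Wfin[OF that] by (intro fmeasurableI) auto
    then have "E A \<in> fmeasurable ?W" using E(2)[OF that] by (auto intro: fmeasurableI2[of A ?W "E A"])
    then have "emeasure ?W (E A) = ennreal (m A)" unfolding m_def by (rule emeasure_eq_measure2)
    moreover have "(ennreal \<gamma>)\<^sup>2 * emeasure ?W A \<le> A2_char w * emeasure ?W (E A)"
      using A2_sparse_subset[OF weight, of A "E A" \<gamma>] E(2)[OF that] that F by auto
    ultimately show ?thesis
      using v[OF that] \<gamma> Q by (simp add: ennreal_power m_def flip: ennreal_mult)
  qed
  have m: "0 < m A" if "A \<in> F" for A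
  proof -
    have "0 < \<gamma>\<^sup>2 * v A" using \<gamma> v[OF that] by simp
    with vm[OF that] Q(2) have "0 < Q * m A" by linarith
    then show ?thesis using Q(2) by (simp add: zero_less_mult_iff)
  qed
  have msum: "sum m H \<le> measure ?W (\<Union>H)" if "H \<subseteq> F" for H
    unfolding m_def using that E Am Wfin F(1) finite_subset[of H F]
    by (intro sum_sparse_le_Union[of E F]) auto
  \<comment> \<open>Members of the superlevel set satisfy only \<open>a A \<le> a B\<close>, whereas
    the weak type asks for a strict inequality; halving the level provides it and turns the constant
    2 into 8.\<close>
  have weak_a: "(a A)\<^sup>2 * sum m {B\<in>F. a A \<le> a B} \<le> 8 * Q * n" if "A \<in> F" for A
  proof (cases "a A = 0")
    case False
    then have aA: "0 < a A" using a(2)[OF that] by simp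
    let ?H = "{B\<in>F. a A \<le> a B}"
    have "(ennreal (a A / 2))\<^sup>2 * emeasure ?W (\<Union>?H) \<le> 2 * A2_char w * (\<integral>\<^sup>+x. ennreal (\<bar>f x\<bar>\<^sup>2 * w x) \<partial>lebesgue)"
      using F aA a by (intro max_avg_weak_type weight f) (auto intro!: ennreal_lessI)
    also have "\<dots> = ennreal (2 * Q * n)"
      using Q n by (simp add: ennreal_mult)
    finally have "(a A / 2)\<^sup>2 * measure ?W (\<Union>?H) \<le> 2 * Q * n"
      using aA Q n by (simp add: eU ennreal_power flip: ennreal_mult)
    then have "(a A)\<^sup>2 * measure ?W (\<Union>?H) \<le> 8 * Q * n" by (simp add: power_divide)
    moreover have "(a A)\<^sup>2 * sum m ?H \<le> (a A)\<^sup>2 * measure ?W (\<Union>?H)"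
      by (intro mult_left_mono msum) auto
    ultimately show ?thesis by linarith
  qed (use Q n in simp)
  \<comment> \<open>The ratio \<open>u A / v A\<close> is the average over \<open>A\<close> of the
    indicator of \<open>G\<close> with respect to \<open>w\<close>, so the weighted density estimate
    applies at this level.\<close>
  have weak_b: "(u A / v A) * sum m {B\<in>F. u A / v A \<le> u B / v B} \<le> 2 * g" if "A \<in> F" for A
  proof (cases "u A = 0")
    case False
    let ?t = "u A / v A"
    have t: "0 < ?t" using False u(2)[OF that] v(2)[OF that] by simp
    let ?H = "{B\<in>F. ?t \<le> u B / v B}"
    have "ennreal ?t * emeasure ?W (\<Union>?H) \<le> 2 * emeasure ?W G"
    proof (rule weighted_density_weak_type[OF weight Gm])
      fix B assume B: "B \<in> ?H"
      then have "?t * v B \<le> u B" using v(2)[of B] by (simp add: pos_le_divide_eq)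
      then show "ennreal ?t * emeasure ?W B \<le> emeasure ?W (B \<inter> G)"
        using B t u v[of B] by (simp flip: ennreal_mult)
    qed (use F t in auto)
    also have "\<dots> = ennreal (2 * g)" using eG by (simp add: ennreal_mult)
    finally have "?t * measure ?W (\<Union>?H) \<le> 2 * g"
      using t eG by (simp add: eU flip: ennreal_mult)
    moreover have "?t * sum m ?H \<le> ?t * measure ?W (\<Union>?H)"
      using t by (intro mult_left_mono msum) auto
    ultimately show ?thesis by linarith
  qed (use eG in simp)
  have main: "(\<Sum>A\<in>F. a A * (u A / v A) * m A) \<le> 4 * sqrt ((8 * Q * n) * (2 * g))"
    using F(1) a(2) m Q n eG weak_a weak_b u v
    by (intro sum_prod_le_of_weak_types) (auto simp: less_imp_le)
  \<comment> \<open>Integrating the inequality that defines \<open>G\<close> over \<open>G\<close>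
    against \<open>w\<close> bounds its mass by the bilinear sum of
    \<open>a A * u A\<close>.\<close>
  have "ennreal l * emeasure ?W G = (\<integral>\<^sup>+x. ennreal l * indicator G x \<partial>?W)"
    using Gm by (simp add: nn_integral_cmult_indicator)
  also have "\<dots> \<le> (\<integral>\<^sup>+x. (\<Sum>A\<in>F. max_avg A f * indicator (A \<inter> G) x) \<partial>?W)"
  proof (rule nn_integral_mono)
    fix x show "ennreal l * indicator G x \<le> (\<Sum>A\<in>F. max_avg A f * indicator (A \<inter> G) x)"
    proof (cases "x \<in> G")
      case True
      then have "ennreal l \<le> (\<Sum>A\<in>F. max_avg A f * indicator A x)" by (simp add: G less_imp_le)
      also have "\<dots> = (\<Sum>A\<in>F. max_avg A f * indicator (A \<inter> G) x)"
        using True by (intro sum.cong) (auto simp: indicator_def)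
      finally show ?thesis using True by simp
    qed simp
  qed
  also have "\<dots> = (\<Sum>A\<in>F. max_avg A f * emeasure ?W (A \<inter> G))"
    using Am Gm by (subst nn_integral_sum)
      (auto intro!: sum.cong nn_integral_cmult_indicator borel_measurable_times_ennreal borel_measurable_indicator)
  also have "\<dots> = ennreal (\<Sum>A\<in>F. a A * u A)"
    using a u by (subst sum_ennreal[symmetric]) (auto intro!: sum.cong simp: ennreal_mult)
  finally have "l * g \<le> (\<Sum>A\<in>F. a A * u A)"
    using l eG a u by (simp add: sum_nonneg flip: ennreal_mult)
  \<comment> \<open>Writing \<open>u A\<close> as \<open>(u A / v A) * v A\<close> leaves a factor
    \<open>v A\<close>, which \<open>vm\<close> exchanges for the mass \<open>m A\<close> at the
    cost of a full factor \<open>Q\<close>.\<close>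
  also have "\<dots> \<le> (\<Sum>A\<in>F. Q / \<gamma>\<^sup>2 * (a A * (u A / v A) * m A))"
  proof (rule sum_mono)
    fix A assume A: "A \<in> F"
    have "v A \<le> Q * m A / \<gamma>\<^sup>2" using vm[OF A] \<gamma> by (simp add: pos_le_divide_eq mult.commute)
    then have "a A * (u A / v A) * v A \<le> a A * (u A / v A) * (Q * m A / \<gamma>\<^sup>2)"
      using a[OF A] u[OF A] v[OF A] by (intro mult_left_mono) auto
    then show "a A * u A \<le> Q / \<gamma>\<^sup>2 * (a A * (u A / v A) * m A)"
      using v[OF A] by (simp add: mult_ac)
  qed
  also have "\<dots> = Q / \<gamma>\<^sup>2 * (\<Sum>A\<in>F. a A * (u A / v A) * m A)" by (simp add: sum_distrib_left)
  also have "\<dots> \<le> Q / \<gamma>\<^sup>2 * (4 * sqrt ((8 * Q * n) * (2 * g)))"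
    using main Q by (intro mult_left_mono) auto
  also have "(8 * Q * n) * (2 * g) = 4\<^sup>2 * (Q * n * g)" by simp
  also have "4 * sqrt (4\<^sup>2 * (Q * n * g)) = 16 * (sqrt Q * sqrt n * sqrt g)"
    by (simp add: real_sqrt_mult)
  finally have "l * g \<le> 16 / \<gamma>\<^sup>2 * (Q * sqrt Q) * sqrt n * sqrt g" by (simp add: mult_ac)
  also have "Q * sqrt Q = Q powr (3/2)"
    using Q(2) powr_add[of Q 1 "1/2"] by (cases "Q = 0") (auto simp: powr_half_sqrt)
  finally have *: "l * g \<le> 16 / \<gamma>\<^sup>2 * Q powr (3/2) * sqrt n * sqrt g" .
  have "sqrt g \<le> 16 / \<gamma>\<^sup>2 * Q powr (3/2) * sqrt n / l"
  proof (cases "g = 0")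
    case False
    then have g: "0 < sqrt g" using eG by simp
    have "sqrt g * l * sqrt g = l * (sqrt g * sqrt g)" by (simp only: mult_ac)
    also have "\<dots> \<le> 16 / \<gamma>\<^sup>2 * Q powr (3/2) * sqrt n * sqrt g" using * eG(2) by simp
    finally have "sqrt g * l \<le> 16 / \<gamma>\<^sup>2 * Q powr (3/2) * sqrt n"
      using g by (rule mult_right_le_imp_le)
    then show ?thesis using l by (simp only: pos_le_divide_eq)
  qed (use l n in simp)
  then have "(sqrt g)\<^sup>2 \<le> (16 / \<gamma>\<^sup>2 * Q powr (3/2) * sqrt n / l)\<^sup>2"
    using eG(2) by (intro power_mono) auto
  then show ?thesis using eG by (simp add: ennreal_leI)
qed

section \<open>From finite subfamilies to the whole sparse family\<close>

text \<open>Only countably many of the disjoint sets \<open>E A\<close> can meet a given ball in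
  positive measure, and each \<open>E A\<close>, being bounded and of positive measure, is contained
  in some ball. Countability allows the family to be exhausted by a sequence of finite
  subfamilies.\<close>

lemma sparse_countable:
  assumes "gamma_sparse \<gamma> S" "0 < \<gamma>"
  shows "countable S"
proof -
  obtain E where S: "S \<subseteq> intervals" and disj: "disjoint_family_on E S"
    and E: "\<And>A. A \<in> S \<Longrightarrow> E A \<in> sets lebesgue \<and> E A \<subseteq> A \<and> ennreal \<gamma> * emeasure lebesgue A \<le> emeasure lebesgue (E A)"
    using assms(1) unfolding gamma_sparse_def by blast
  let ?\<mu> = "\<lambda>k A. measure lebesgue (E A \<inter> cball 0 (real k))"
  have fm: "E A \<inter> cball 0 (real k) \<in> lmeasurable" if "A \<in> S" for A k
    using E[OF that] 
    by (auto intro!: fmeasurable_Int_fmeasurable simp: Int_commute[of "E A"])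
  have "countable {A\<in>S. ?\<mu> k A \<noteq> 0}" for k
  proof (rule summable_countable_real, rule nonneg_bdd_above_summable_on)
    show "bdd_above (sum (?\<mu> k) ` {F. F \<subseteq> S \<and> finite F})"
    proof (rule bdd_aboveI2)
      fix F assume F: "F \<in> {F. F \<subseteq> S \<and> finite F}"
      have "disjoint_family_on (\<lambda>A. E A \<inter> cball 0 (real k)) F"
        using F disj unfolding disjoint_family_on_def by blast
      then have "sum (?\<mu> k) F = measure lebesgue (\<Union>A\<in>F. E A \<inter> cball 0 (real k))"
        using F fm fmeasurableD2[OF fm] by (intro measure_finite_Union[symmetric]) auto
      also have "\<dots> \<le> measure lebesgue (cball (0::real) (real k))"
        using F fmeasurableD[OF fm] by (intro measure_mono_fmeasurable sets.finite_UN) auto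
      finally show "sum (?\<mu> k) F \<le> measure lebesgue (cball (0::real) (real k))" .
    qed
  qed simp
  then have "countable (\<Union>k. {A\<in>S. ?\<mu> k A \<noteq> 0})" by simp
  moreover have "S \<subseteq> (\<Union>k. {A\<in>S. ?\<mu> k A \<noteq> 0})"
  proof
    fix A assume A: "A \<in> S"
    then have AI: "A \<in> intervals" using S by auto
    have "bounded A" using AI by (auto simp: intervals_def)
    then obtain r where "A \<subseteq> cball 0 r"
      using bounded_subset_ballD ball_subset_cball by (metis subset_trans)
    moreover obtain k :: nat where "r \<le> real k" using real_arch_simple by blast
    ultimately have "A \<subseteq> cball 0 (real k)" by (auto simp: cball_def)
    then have eq: "E A \<inter> cball 0 (real k) = E A" using E[OF A] by auto
    have "0 < ennreal \<gamma> * emeasure lebesgue A"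
      using intervals_emeasure[OF AI] assms(2) by (auto simp: ennreal_zero_less_mult_iff)
    then have "0 < emeasure lebesgue (E A)" using E[OF A] by (auto intro: less_le_trans)
    moreover have "emeasure lebesgue (E A) = ennreal (measure lebesgue (E A))"
      using fm[OF A, of k] eq by (intro emeasure_eq_measure2) auto
    ultimately have "?\<mu> k A \<noteq> 0" unfolding eq by auto
    then show "A \<in> (\<Union>k. {A\<in>S. ?\<mu> k A \<noteq> 0})" using A by auto
  qed
  ultimately show ?thesis by (rule countable_subset[rotated])
qed

lemma sqrt_ennreal_ennreal: "0 \<le> x \<Longrightarrow> sqrt_ennreal (ennreal x) = ennreal (sqrt x)"
  by (simp add: sqrt_ennreal_def)

lemma sqrt_ennreal_le_iff: "0 \<le> y \<Longrightarrow> sqrt_ennreal x \<le> ennreal y \<longleftrightarrow> x \<le> ennreal (y\<^sup>2)"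
  by (cases x) (auto simp: sqrt_ennreal_def top_unique real_le_rsqrt sqrt_le_D real_sqrt_le_iff' real_le_lsqrt)

text \<open>The bound for finite subfamilies is uniform in their size, so it passes to the level set
  of the full sum by continuity of the measure from below.\<close>

lemma strong_sparse_op_weak_bound:
  assumes S: "gamma_sparse \<gamma> S" and \<gamma>: "0 < \<gamma>" and w: "A2_weight w"
  shows "op_norm_L2 w (weak_L2_norm w) (strong_sparse_op S)
    \<le> ennreal (16 / \<gamma>\<^sup>2 * enn2real (A2_char w) powr (3/2))"
  unfolding op_norm_L2_def
proof (rule SUP_least)
  fix f assume "f \<in> {f \<in> borel_measurable lebesgue. 0 < L2_norm w f \<and> L2_norm w f < top}"
  then have f: "f \<in> borel_measurable lebesgue" and nf: "0 < L2_norm w f" "L2_norm w f < top" by auto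
  define I where "I = (\<integral>\<^sup>+x. ennreal (\<bar>f x\<bar>\<^sup>2 * w x) \<partial>lebesgue)"
  have "I \<noteq> top" using nf(2) unfolding L2_norm_def I_def by (auto simp: sqrt_ennreal_def)
  then obtain n where n: "I = ennreal n" "0 \<le> n" by (cases I) auto
  have Ln: "L2_norm w f = ennreal (sqrt n)"
    unfolding L2_norm_def using n by (simp add: I_def sqrt_ennreal_ennreal)
  define Q where "Q = enn2real (A2_char w)"
  have Q: "A2_char w = ennreal Q" "0 \<le> Q" using w by (auto simp: A2_weight_def Q_def)
  define K where "K = 16 / \<gamma>\<^sup>2 * Q powr (3/2)"
  have K: "0 \<le> K" by (simp add: K_def)
  obtain E where SI: "S \<subseteq> intervals" and disj: "disjoint_family_on E S"
    and E: "\<And>A. A \<in> S \<Longrightarrow> E A \<in> sets lebesgue \<and> E A \<subseteq> A \<and> ennreal \<gamma> * emeasure lebesgue A \<le> emeasure lebesgue (E A)"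
    using S unfolding gamma_sparse_def by blast
  have cS: "countable S" using S \<gamma> by (rule sparse_countable)
  define F where "F = (\<lambda>k. {A\<in>S. to_nat_on S A < k})"
  have finF: "finite (F k)" for k
    using inj_on_finite[of "to_nat_on S" "F k" "{..<k}"] inj_on_to_nat_on[OF cS]
    by (auto simp: F_def inj_on_def)
  have F: "F k \<subseteq> S" "F k \<subseteq> F (Suc k)" for k by (auto simp: F_def)
  have FI: "A \<in> sets lebesgue" if "A \<in> F k" for A k
    using that SI F(1) intervals_sets by blast
  have wm: "w \<in> borel_measurable lebesgue" using w by (auto simp: A2_weight_def weight_def)
  have "weak_L2_norm w (strong_sparse_op S f) \<le> ennreal (K * sqrt n)"
    unfolding weak_L2_norm_def
  proof (rule SUP_least)
    fix l :: real assume "l \<in> {0<..}"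
    then have l: "0 < l" by simp
    define G where "G = (\<lambda>k. {x. ennreal l < (\<Sum>A\<in>F k. max_avg A f * indicator A x)})"
    have incG: "incseq G"
      unfolding G_def
      by (intro incseq_SucI Collect_mono impI) (erule less_le_trans, rule sum_mono2[OF finF F(2)], simp)
    have Gm: "G k \<in> sets lebesgue" for k
    proof -
      have "(\<lambda>x. \<Sum>A\<in>F k. max_avg A f * indicator A x) \<in> borel_measurable lebesgue"
        using FI
        by (intro borel_measurable_sum borel_measurable_times_ennreal borel_measurable_indicator) auto
      then have "{x\<in>space lebesgue. ennreal l < (\<Sum>A\<in>F k. max_avg A f * indicator A x)} \<in> sets lebesgue"
        by measurable
      then show ?thesis by (simp add: G_def)
    qed
    have Gle: "emeasure (wmeas w) (G k) \<le> ennreal ((K * sqrt n / l)\<^sup>2)" for k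
      unfolding K_def
    proof (rule finite_sparse_sum_weak_type[where F = "F k" and E = E and f = f])
      show "F k \<subseteq> intervals" using SI F(1) by blast
      show "disjoint_family_on E (F k)" using disjoint_family_on_mono[OF F(1) disj] .
      show "E A \<in> sets lebesgue \<and> E A \<subseteq> A \<and> ennreal \<gamma> * emeasure lebesgue A \<le> emeasure lebesgue (E A)"
        if "A \<in> F k" for A using E that F(1) by blast
    qed (use w f n finF l \<gamma> Q in \<open>auto simp: I_def G_def\<close>)
    \<comment> \<open>The strict inequality matters: a supremum of finite sums exceeds
      \<open>l\<close> only if one of these sums does, and its index set lies in some
      \<open>F k\<close>.\<close>
    have "{x. ennreal l < strong_sparse_op S f x} = (\<Union>k. G k)"
    proof (intro set_eqI iffI)
      fix x assume "x \<in> {x. ennreal l < strong_sparse_op S f x}"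
      then have "ennreal l < (SUP H\<in>{H. finite H \<and> H \<subseteq> S}. \<Sum>A\<in>H. max_avg A f * indicator A x)"
        unfolding strong_sparse_op_def by (simp add: nonneg_infsum_complete)
      then obtain H where H: "finite H" "H \<subseteq> S" "ennreal l < (\<Sum>A\<in>H. max_avg A f * indicator A x)"
        unfolding less_SUP_iff by blast
      obtain k where "\<And>A. A \<in> H \<Longrightarrow> to_nat_on S A < k"
        using finite_nat_set_iff_bounded[of "to_nat_on S ` H"] H(1) by auto
      then have "H \<subseteq> F k" using H(2) by (auto simp: F_def)
      then have "(\<Sum>A\<in>H. max_avg A f * indicator A x) \<le> (\<Sum>A\<in>F k. max_avg A f * indicator A x)"
        using finF by (intro sum_mono2) auto
      with H(3) show "x \<in> (\<Union>k. G k)" by (auto simp: G_def intro: less_le_trans)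
    next
      fix x assume "x \<in> (\<Union>k. G k)"
      then obtain k where "ennreal l < (\<Sum>A\<in>F k. max_avg A f * indicator A x)" by (auto simp: G_def)
      also have "\<dots> \<le> (SUP H\<in>{H. finite H \<and> H \<subseteq> S}. \<Sum>A\<in>H. max_avg A f * indicator A x)"
        using finF F by (intro SUP_upper) auto
      also have "\<dots> = strong_sparse_op S f x"
        unfolding strong_sparse_op_def by (simp add: nonneg_infsum_complete)
      finally show "x \<in> {x. ennreal l < strong_sparse_op S f x}" by simp
    qed
    moreover have "(\<integral>\<^sup>+x\<in>(\<Union>k. G k). ennreal (w x) \<partial>lebesgue) = emeasure (wmeas w) (\<Union>k. G k)"
      using wm Gm by (intro emeasure_wmeas[symmetric]) auto
    moreover have "emeasure (wmeas w) (\<Union>k. G k) = (SUP k. emeasure (wmeas w) (G k))"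
      using incG Gm by (intro SUP_emeasure_incseq[symmetric]) auto
    moreover have "\<dots> \<le> ennreal ((K * sqrt n / l)\<^sup>2)" using Gle by (rule SUP_least)
    ultimately have "(\<integral>\<^sup>+x\<in>{x. ennreal l < strong_sparse_op S f x}. ennreal (w x) \<partial>lebesgue) \<le> ennreal ((K * sqrt n / l)\<^sup>2)"
      by simp
    then have "sqrt_ennreal (\<integral>\<^sup>+x\<in>{x. ennreal l < strong_sparse_op S f x}. ennreal (w x) \<partial>lebesgue) \<le> ennreal (K * sqrt n / l)"
      using K l n by (subst sqrt_ennreal_le_iff) auto
    then have "ennreal l * sqrt_ennreal (\<integral>\<^sup>+x\<in>{x. ennreal l < strong_sparse_op S f x}. ennreal (w x) \<partial>lebesgue)
        \<le> ennreal l * ennreal (K * sqrt n / l)"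
      by (rule mult_left_mono) simp
    also have "\<dots> = ennreal (K * sqrt n)"
      using l K n by (simp flip: ennreal_mult)
    finally show "ennreal l * sqrt_ennreal (\<integral>\<^sup>+x\<in>{x. ennreal l < strong_sparse_op S f x}. ennreal (w x) \<partial>lebesgue)
        \<le> ennreal (K * sqrt n)" .
  qed
  then have "weak_L2_norm w (strong_sparse_op S f) / L2_norm w f \<le> ennreal (K * sqrt n) / ennreal (sqrt n)"
    unfolding Ln by (rule divide_right_mono_ennreal)
  also have "\<dots> = ennreal K"
    using nf(1) K n unfolding Ln by (subst divide_ennreal) auto
  finally show "weak_L2_norm w (strong_sparse_op S f) / L2_norm w f
    \<le> ennreal (16 / \<gamma>\<^sup>2 * enn2real (A2_char w) powr (3/2))"
    by (simp add: K_def Q_def)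
qed

subsection \<open>Power weights and the extremal example\<close>

text \<open>The endpoints are \<open>Inf I\<close> and \<open>Sup I\<close>; \<open>I\<close> lies
  between the open and the closed interval with these endpoints, which have equal measure.\<close>

lemma intervals_endpoints:
  assumes "I \<in> intervals"
  obtains a b :: real where "a < b" "I \<subseteq> {a..b}" "emeasure lebesgue I = ennreal (b - a)"
proof -
  have I: "is_interval I" "bounded I" "0 < emeasure lebesgue I" using assms by (auto simp: intervals_def)
  then have ne: "I \<noteq> {}" by auto
  have bdd: "bdd_below I" "bdd_above I" using I(2) bounded_imp_bdd_below bounded_imp_bdd_above by auto
  define a b where "a = Inf I" and "b = Sup I"
  have sub: "I \<subseteq> {a..b}" using bdd by (auto simp: a_def b_def cInf_lower cSup_upper)
  have sup: "{a<..<b} \<subseteq> I"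
  proof
    fix x assume "x \<in> {a<..<b}"
    then obtain u v where "u \<in> I" "u < x" "v \<in> I" "x < v"
      using ne bdd by (auto simp: a_def b_def cInf_less_iff less_cSup_iff)
    then show "x \<in> I" using I(1) unfolding is_interval_1 by (meson less_imp_le)
  qed
  have ab: "a \<le> b" using sub ne by force
  have "emeasure lebesgue I \<le> emeasure lebesgue {a..b}" using sub by (intro emeasure_mono) auto
  moreover have "emeasure lebesgue {a<..<b} \<le> emeasure lebesgue I"
    using sup intervals_sets[OF assms] by (intro emeasure_mono) auto
  ultimately have e: "emeasure lebesgue I = ennreal (b - a)" using ab by auto
  then have "a < b" using I(3) ab by auto
  with sub e that show ?thesis by blast
qed

lemma atLeastAtMost_intervals: "a < b \<Longrightarrow> {a..b::real} \<in> intervals"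
  by (auto simp: intervals_def is_interval_cc)

lemma ennreal_divide_one: "x / 1 = (x :: ennreal)"
  using ennreal_mult_divide_eq[of 1 x] by simp

text \<open>A weight must be positive everywhere, while \<open>0 powr a = 0\<close>.\<close>

definition power_weight :: "real \<Rightarrow> real \<Rightarrow> real" where
  "power_weight \<alpha> x = (if x = 0 then 1 else \<bar>x\<bar> powr (\<alpha> - 1))"

lemma power_weight_measurable [measurable]: "power_weight \<alpha> \<in> borel_measurable borel"
  unfolding power_weight_def by measurable

lemma power_weight_measurable_lebesgue: "power_weight \<alpha> \<in> borel_measurable lebesgue"
  using measurable_completion[of "power_weight \<alpha>" lborel borel] by simp

lemma weight_power_weight: "weight (power_weight \<alpha>)"
  using power_weight_measurable_lebesgue by (auto simp: weight_def power_weight_def)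

lemma nn_integral_powr_0:
  assumes "- 1 < a" "0 \<le> m"
  shows "(\<integral>\<^sup>+x\<in>{0..m}. ennreal (x powr a) \<partial>lborel) = ennreal (m powr (a + 1) / (a + 1))"
  using has_integral_powr_from_0[OF assms] by (intro nn_integral_has_integral_lebesgue') auto

lemma nn_integral_power_weight:
  assumes "0 < \<alpha>" "0 \<le> m"
  shows "(\<integral>\<^sup>+x\<in>{0..m}. ennreal (power_weight \<alpha> x) \<partial>lborel) = ennreal (m powr \<alpha> / \<alpha>)"
proof -
  have "(\<integral>\<^sup>+x\<in>{0..m}. ennreal (power_weight \<alpha> x) \<partial>lborel)
      = (\<integral>\<^sup>+x\<in>{0..m}. ennreal (x powr (\<alpha> - 1)) \<partial>lborel)"
    by (intro nn_integral_cong_AE eventually_mono[OF AE_lborel_singleton[of 0]])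
      (auto simp: power_weight_def indicator_def)
  then show ?thesis using nn_integral_powr_0[of "\<alpha> - 1" m] assms by simp
qed

lemma nn_integral_inverse_power_weight:
  assumes "\<alpha> < 2" "0 \<le> m"
  shows "(\<integral>\<^sup>+x\<in>{0..m}. ennreal (inverse (power_weight \<alpha> x)) \<partial>lborel) = ennreal (m powr (2 - \<alpha>) / (2 - \<alpha>))"
proof -
  have "(\<integral>\<^sup>+x\<in>{0..m}. ennreal (inverse (power_weight \<alpha> x)) \<partial>lborel)
      = (\<integral>\<^sup>+x\<in>{0..m}. ennreal (x powr (1 - \<alpha>)) \<partial>lborel)"
    by (intro nn_integral_cong_AE eventually_mono[OF AE_lborel_singleton[of 0]])
      (auto simp: power_weight_def indicator_def simp flip: powr_minus)
  then show ?thesis using nn_integral_powr_0[of "1 - \<alpha>" m] assms by simp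
qed

text \<open>The weight is even, so both halves contribute equally; counting the origin twice is
  harmless in an upper bound.\<close>

lemma nn_integral_power_weight_symmetric:
  assumes "0 < \<alpha>" "0 \<le> m"
  shows "(\<integral>\<^sup>+x\<in>{-m..m}. ennreal (power_weight \<alpha> x) \<partial>lborel) \<le> ennreal (2 * (m powr \<alpha> / \<alpha>))"
proof -
  let ?w = "\<lambda>x. ennreal (power_weight \<alpha> x)"
  have refl: "(\<integral>\<^sup>+x\<in>{-m..0}. ?w x \<partial>lborel) = (\<integral>\<^sup>+x\<in>{0..m}. ?w x \<partial>lborel)"
    by (subst nn_integral_real_affine[where c = "-1" and t = 0])
      (auto intro!: nn_integral_cong simp: power_weight_def indicator_def)
  have "(\<integral>\<^sup>+x\<in>{-m..m}. ?w x \<partial>lborel) \<le> (\<integral>\<^sup>+x. ?w x * indicator {-m..0} x + ?w x * indicator {0..m} x \<partial>lborel)"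
    by (intro nn_integral_mono) (auto simp: indicator_def)
  also have "\<dots> = (\<integral>\<^sup>+x\<in>{-m..0}. ?w x \<partial>lborel) + (\<integral>\<^sup>+x\<in>{0..m}. ?w x \<partial>lborel)"
    by (intro nn_integral_add) auto
  also have "\<dots> = ennreal (2 * (m powr \<alpha> / \<alpha>))"
    using nn_integral_power_weight[OF assms] assms refl by (simp flip: ennreal_plus)
  finally show ?thesis .
qed

lemma avg_le_of_AE:
  assumes "I \<in> intervals" "AE x in lborel. x \<in> I \<longrightarrow> \<bar>g x\<bar> \<le> c" "0 \<le> c"
  shows "avg I g \<le> ennreal c"
proof -
  have "(\<integral>\<^sup>+x\<in>I. ennreal \<bar>g x\<bar> \<partial>lebesgue) \<le> (\<integral>\<^sup>+x. ennreal c * indicator I x \<partial>lebesgue)"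
    using AE_completion[OF assms(2)]
    by (intro nn_integral_mono_AE, eventually_elim) (auto simp: indicator_def intro: ennreal_leI)
  also have "\<dots> = ennreal c * emeasure lebesgue I"
    using intervals_sets[OF assms(1)] by (rule nn_integral_cmult_indicator)
  finally have "avg I g \<le> ennreal c * emeasure lebesgue I / emeasure lebesgue I"
    unfolding avg_def by (rule divide_right_mono_ennreal)
  also have "\<dots> = ennreal c"
    using intervals_emeasure[OF assms(1)] by (intro ennreal_mult_divide_eq) auto
  finally show ?thesis .
qed

text \<open>The cases are whether \<open>I\<close> is long or short compared with its distance to the origin; in the
  second one the weight is essentially constant on \<open>I\<close>.\<close>

lemma A2_char_power_weight_le:
  assumes \<alpha>: "0 < \<alpha>" "\<alpha> \<le> 1"
  shows "A2_char (power_weight \<alpha>) \<le> ennreal (4 / \<alpha>)"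
  unfolding A2_char_def
proof (rule SUP_least)
  fix I assume I: "I \<in> intervals"
  then obtain a b where ab: "a < b" "I \<subseteq> {a..b}" "emeasure lebesgue I = ennreal (b - a)"
    by (rule intervals_endpoints)
  \<comment> \<open>The largest distance from the origin to a point of \<open>{a..b}\<close>. Both
    averages are compared with the value of the weight or its reciprocal at this distance.\<close>
  define m where "m = max \<bar>a\<bar> \<bar>b\<bar>"
  have "{a..b} \<subseteq> {-m..m}" by (auto simp: m_def)
  then have m: "0 < m" "I \<subseteq> {-m..m}" using ab by (auto simp: m_def)
  have xm: "\<bar>x\<bar> \<le> m" if "x \<in> I" for x using m(2) that by (auto simp: abs_le_iff subset_iff)
  have pm: "0 < m powr (\<alpha> - 1)" using m by simp
  \<comment> \<open>The reciprocal weight is nondecreasing in the distance from the origin, apart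
    from the artificial value at 0, which the almost everywhere bound ignores.\<close>
  have \<sigma>: "avg I (\<lambda>x. inverse (power_weight \<alpha> x)) \<le> ennreal (m powr (1 - \<alpha>))"
  proof (rule avg_le_of_AE[OF I])
    show "AE x in lborel. x \<in> I \<longrightarrow> \<bar>inverse (power_weight \<alpha> x)\<bar> \<le> m powr (1 - \<alpha>)"
      using AE_lborel_singleton[of "0::real"]
    proof eventually_elim
      case (elim x)
      have "\<bar>x\<bar> powr (1 - \<alpha>) \<le> m powr (1 - \<alpha>)" if "x \<in> I"
        using xm[OF that] \<alpha> by (intro powr_mono2) auto
      with elim show ?case by (simp add: power_weight_def flip: powr_minus)
    qed
  qed simp
  have w: "avg I (power_weight \<alpha>) \<le> ennreal (4 / \<alpha> * m powr (\<alpha> - 1))"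
  proof (cases "m \<le> 2 * (b - a)")
    case True
    have "(\<integral>\<^sup>+x\<in>I. ennreal \<bar>power_weight \<alpha> x\<bar> \<partial>lebesgue) \<le> (\<integral>\<^sup>+x\<in>{-m..m}. ennreal (power_weight \<alpha> x) \<partial>lebesgue)"
      using m(2) by (intro nn_integral_mono) (auto simp: indicator_def power_weight_def)
    also have "\<dots> \<le> ennreal (2 * (m powr \<alpha> / \<alpha>))"
      using nn_integral_power_weight_symmetric[of \<alpha> m] \<alpha> m by (simp add: nn_integral_completion)
    finally have "avg I (power_weight \<alpha>) \<le> ennreal (2 * (m powr \<alpha> / \<alpha>)) / ennreal (b - a)"
      unfolding avg_def ab(3) by (rule divide_right_mono_ennreal)
    also have "\<dots> = ennreal (2 * (m powr \<alpha> / \<alpha>) / (b - a))"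
      using ab \<alpha> by (intro divide_ennreal) auto
    also have "\<dots> \<le> ennreal (4 / \<alpha> * m powr (\<alpha> - 1))"
    proof (rule ennreal_leI)
      have "m powr \<alpha> = m * m powr (\<alpha> - 1)" using m powr_mult_base[of m "\<alpha> - 1"] by simp
      also have "\<dots> \<le> 2 * (b - a) * m powr (\<alpha> - 1)" using True by (intro mult_right_mono) auto
      finally have "m powr \<alpha> / (b - a) \<le> 2 * m powr (\<alpha> - 1)"
        using ab by (subst pos_divide_le_eq) (auto simp: algebra_simps)
      then have "2 / \<alpha> * (m powr \<alpha> / (b - a)) \<le> 2 / \<alpha> * (2 * m powr (\<alpha> - 1))"
        using \<alpha> by (intro mult_left_mono) auto
      then show "2 * (m powr \<alpha> / \<alpha>) / (b - a) \<le> 4 / \<alpha> * m powr (\<alpha> - 1)"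
        by (simp add: mult_ac)
    qed
    finally show ?thesis .
  next
    case False
    \<comment> \<open>Every point of \<open>I\<close> is at distance at least \<open>m / 2\<close>
      from the origin, so the weight is at most \<open>2 * m powr (\<alpha> - 1)\<close> on
      \<open>I\<close>.\<close>
    show ?thesis
    proof (rule avg_le_of_AE[OF I], rule AE_I2, rule impI)
      fix x assume "x \<in> I"
      then have "a \<le> x" "x \<le> b" using ab(2) by auto
      then have "m - (b - a) \<le> \<bar>x\<bar>" by (auto simp: m_def max_def abs_if)
      then have "m / 2 \<le> \<bar>x\<bar>" using False by simp
      then have "x \<noteq> 0" "\<bar>x\<bar> powr (\<alpha> - 1) \<le> (m / 2) powr (\<alpha> - 1)"
        using m \<alpha> by (auto intro: powr_mono2')
      note this(2)
      also have "(m / 2) powr (\<alpha> - 1) = m powr (\<alpha> - 1) * 2 powr (1 - \<alpha>)"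
      proof -
        have "2 powr (1 - \<alpha>) = inverse (2 powr (\<alpha> - 1))"
          using powr_minus[of 2 "\<alpha> - 1"] by simp
        moreover have "(m / 2) powr (\<alpha> - 1) = m powr (\<alpha> - 1) / 2 powr (\<alpha> - 1)"
          using m by (simp add: powr_divide)
        ultimately show ?thesis by (simp only: divide_inverse)
      qed
      also have "\<dots> \<le> m powr (\<alpha> - 1) * 2"
        using powr_mono[of "1 - \<alpha>" 1 2] \<alpha> by (intro mult_left_mono) auto
      also have "\<dots> \<le> m powr (\<alpha> - 1) * (4 / \<alpha>)"
        using \<alpha> pm by (intro mult_left_mono) (auto simp: field_simps)
      finally show "\<bar>power_weight \<alpha> x\<bar> \<le> 4 / \<alpha> * m powr (\<alpha> - 1)"
        using \<open>x \<noteq> 0\<close> by (simp add: power_weight_def mult.commute)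
    qed (use \<alpha> in simp)
  qed
  have "avg I (power_weight \<alpha>) * avg I (\<lambda>x. inverse (power_weight \<alpha> x))
      \<le> ennreal (4 / \<alpha> * m powr (\<alpha> - 1)) * ennreal (m powr (1 - \<alpha>))"
    using w \<sigma> by (intro mult_mono) auto
  also have "\<dots> = ennreal (4 / \<alpha> * (m powr (\<alpha> - 1) * m powr (1 - \<alpha>)))"
    using \<alpha> by (simp add: mult.assoc flip: ennreal_mult)
  also have "m powr (\<alpha> - 1) * m powr (1 - \<alpha>) = 1"
    using m by (simp flip: powr_add)
  finally show "avg I (power_weight \<alpha>) * avg I (\<lambda>x. inverse (power_weight \<alpha> x)) \<le> ennreal (4 / \<alpha>)"
    by simp
qed

text \<open>The interval \<open>{0..1}\<close> already gives the product
  \<open>1 / (\<alpha> * (2 - \<alpha>))\<close>.\<close>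

lemma A2_char_power_weight_ge:
  assumes \<alpha>: "0 < \<alpha>" "\<alpha> \<le> 1"
  shows "ennreal (1 / (2 * \<alpha>)) \<le> A2_char (power_weight \<alpha>)"
proof -
  have pos: "\<bar>power_weight \<alpha> x\<bar> = power_weight \<alpha> x" for x by (simp add: power_weight_def)
  have "ennreal (1 / (2 * \<alpha>)) \<le> ennreal (1 / \<alpha> * (1 / (2 - \<alpha>)))"
    using \<alpha> by (intro ennreal_leI) (simp add: field_simps)
  also have "\<dots> = ennreal (1 / \<alpha>) * ennreal (1 / (2 - \<alpha>))"
    using \<alpha> by (intro ennreal_mult) auto
  also have "\<dots> = avg {0..1} (power_weight \<alpha>) * avg {0..1} (\<lambda>x. inverse (power_weight \<alpha> x))"
    using nn_integral_power_weight[of \<alpha> 1] nn_integral_inverse_power_weight[of \<alpha> 1] \<alpha>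
    by (simp add: avg_def nn_integral_completion pos ennreal_divide_one)
  also have "\<dots> \<le> A2_char (power_weight \<alpha>)"
    by (intro avg_A2_le atLeastAtMost_intervals) simp
  finally show ?thesis .
qed

section \<open>The nested family and the lower bound for the operator norm\<close>

definition dyadic_family :: "real set set" where
  "dyadic_family = range (\<lambda>k::nat. {0..(1/2)^k})"

lemma sparse_dyadic_family: "sparse_family dyadic_family"
proof -
  \<comment> \<open>The right half of \<open>A\<close>, written through \<open>Sup A\<close> because
    it has to depend on the set and not on its index. It is left-open because consecutive halves
    would otherwise share an endpoint.\<close>
  let ?E = "\<lambda>A::real set. {Sup A / 2<..Sup A}"
  have Sup: "Sup {0..(1/2::real)^k} = (1/2)^k" for k by simp
  have disj: "?E {0..(1/2::real)^j} \<inter> ?E {0..(1/2)^k} = {}" if "j < k" for j k :: nat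
  proof -
    have "(1/2::real)^k \<le> (1/2)^(Suc j)" using that by (intro power_decreasing) auto
    then show ?thesis unfolding Sup by auto
  qed
  have "gamma_sparse (1/2) dyadic_family"
    unfolding gamma_sparse_def
  proof (intro conjI exI ballI)
    show "dyadic_family \<subseteq> intervals"
      by (auto simp: dyadic_family_def intro!: atLeastAtMost_intervals)
    show "disjoint_family_on ?E dyadic_family"
      unfolding disjoint_family_on_def
    proof (intro ballI impI)
      fix A B assume "A \<in> dyadic_family" "B \<in> dyadic_family" and ne: "A \<noteq> B"
      then obtain j k :: nat where AB: "A = {0..(1/2)^j}" "B = {0..(1/2)^k}"
        by (auto simp: dyadic_family_def)
      with ne have "j < k \<or> k < j" by (metis linorder_neqE_nat)
      then show "?E A \<inter> ?E B = {}" unfolding AB using disj[of j k] disj[of k j] by blast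
    qed
    fix A assume "A \<in> dyadic_family"
    then obtain k :: nat where A: "A = {0..(1/2)^k}" by (auto simp: dyadic_family_def)
    show "?E A \<in> sets lebesgue" by auto
    have r: "0 < (1/2::real)^k" by simp
    show "?E A \<subseteq> A" using r unfolding A Sup by auto
    have "ennreal (1/2) * emeasure lebesgue A = ennreal (1/2) * ennreal ((1/2)^k)" by (simp add: A)
    also have "\<dots> = ennreal (1/2 * (1/2)^k)" by (intro ennreal_mult[symmetric]) auto
    also have "\<dots> = emeasure lebesgue (?E A)" unfolding A Sup by simp
    finally show "ennreal (1/2) * emeasure lebesgue A \<le> emeasure lebesgue (?E A)" by simp
  qed
  then show ?thesis unfolding sparse_family_def by (intro exI[of _ "1/2"]) auto
qed

text \<open>The point lies in the \<open>N + 1\<close> intervals of index at most \<open>N\<close>,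
  each contained in \<open>{0..2}\<close>, where the indicator has average 1/2. Its averages over
  the intervals themselves vanish, so the supremum over larger intervals is essential.\<close>

lemma strong_sparse_op_dyadic_ge:
  assumes "x \<in> {0..(1/2)^N}"
  shows "ennreal (real (Suc N) / 2) \<le> strong_sparse_op dyadic_family (indicat_real {1..2}) x"
proof -
  let ?f = "indicat_real {1..2::real}" and ?A = "\<lambda>k::nat. {0..(1/2::real)^k}"
  \<comment> \<open>The family is a set, so injectivity is what keeps terms from merging when a sum
    over indices becomes a sum over members.\<close>
  have inj: "inj ?A"
  proof (rule injI)
    fix j k :: nat assume "?A j = ?A k"
    then have "(1/2::real)^j = (1/2)^k" by (simp add: Icc_eq_Icc)
    then show "j = k" by (simp add: power_inject_exp')
  qed
  have M: "ennreal (1/2) \<le> max_avg (?A k) ?f" for k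
  proof -
    have "(1/2::real)^k \<le> 1" by (simp add: power_le_one)
    then have "{0..2::real} \<in> {A \<in> intervals. ?A k \<subseteq> A}" by (auto intro: atLeastAtMost_intervals)
    then have "avg {0..2} ?f \<le> max_avg (?A k) ?f" unfolding max_avg_def by (rule SUP_upper)
    moreover have "(\<integral>\<^sup>+x\<in>{0..2}. ennreal \<bar>?f x\<bar> \<partial>lebesgue) = (\<integral>\<^sup>+x. indicator {1..2::real} x \<partial>lebesgue)"
      by (intro nn_integral_cong) (auto simp: indicator_def)
    then have "avg {0..2} ?f = ennreal (1/2)"
      unfolding avg_def by (simp add: divide_ennreal flip: ennreal_numeral ennreal_1)
    ultimately show ?thesis by simp
  qed
  have x: "x \<in> ?A k" if "k \<le> N" for k
  proof -
    have "(1/2::real)^N \<le> (1/2)^k" using that by (intro power_decreasing) auto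
    with assms show ?thesis by (meson atLeastAtMost_iff order_trans)
  qed
  have "real (Suc N) / 2 = (\<Sum>k\<le>N. 1/2)" by simp
  then have "ennreal (real (Suc N) / 2) = (\<Sum>k\<le>N. ennreal (1/2))"
    by (simp only: sum_ennreal)
  also have "\<dots> \<le> (\<Sum>k\<le>N. max_avg (?A k) ?f * indicator (?A k) x)"
    using M x by (intro sum_mono) simp
  also have "\<dots> = (\<Sum>A\<in>?A ` {..N}. max_avg A ?f * indicator A x)"
    using inj by (subst sum.reindex) (auto intro: inj_on_subset)
  also have "\<dots> \<le> (SUP H\<in>{H. finite H \<and> H \<subseteq> dyadic_family}. \<Sum>A\<in>H. max_avg A ?f * indicator A x)"
    by (intro SUP_upper) (auto simp: dyadic_family_def)
  also have "\<dots> = strong_sparse_op dyadic_family ?f x"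
    unfolding strong_sparse_op_def by (simp add: nonneg_infsum_complete)
  finally show ?thesis .
qed

lemma sqrt_ennreal_mono: "x \<le> y \<Longrightarrow> sqrt_ennreal x \<le> sqrt_ennreal y"
  by (auto simp: sqrt_ennreal_def top_unique less_top intro!: ennreal_leI enn2real_mono)

text \<open>With \<open>\<alpha> = 1 / N\<close> the interval \<open>{0..(1/2)^N}\<close> keeps half
  of the mass \<open>N\<close> of \<open>{0..1}\<close>. The level N/2 times the square root of the
  mass N/2 gives the power 3/2.\<close>

lemma op_norm_power_weight_ge:
  fixes N :: nat
  assumes "0 < N"
  shows "ennreal ((real N / 2) powr (3/2))
    \<le> op_norm_L2 (power_weight (1 / real N)) (weak_L2_norm (power_weight (1 / real N))) (strong_sparse_op dyadic_family)"
proof -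
  define \<alpha> where "\<alpha> = 1 / real N"
  have \<alpha>: "0 < \<alpha>" "\<alpha> \<le> 1" using assms by (auto simp: \<alpha>_def)
  let ?w = "power_weight \<alpha>" and ?f = "indicat_real {1..2::real}"
  let ?T = "strong_sparse_op dyadic_family ?f"
  let ?G = "{x. ennreal (real N / 2) < ?T x}"
  have wpos: "0 < ?w x" for x by (simp add: power_weight_def)
  define J where "J = (\<integral>\<^sup>+x. ennreal (\<bar>?f x\<bar>\<^sup>2 * ?w x) \<partial>lebesgue)"
  have J_eq: "J = emeasure (wmeas ?w) {1..2}"
    unfolding J_def by (subst emeasure_wmeas[OF power_weight_measurable_lebesgue])
      (auto intro!: nn_integral_cong simp: indicator_def)
  have "0 < emeasure (wmeas ?w) {1..2}"
    by (intro emeasure_wmeas_pos power_weight_measurable_lebesgue wpos) auto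
  then have J0: "0 < J" by (simp add: J_eq)
  \<comment> \<open>On \<open>{1..2}\<close> the weight is at most 1 because the exponent
    \<open>\<alpha> - 1\<close> is nonpositive; dividing by the norm of the test function can then
    only increase the quotient.\<close>
  have "J \<le> (\<integral>\<^sup>+x. indicator {1..2::real} x \<partial>lebesgue)"
    unfolding J_def
  proof (rule nn_integral_mono)
    fix x :: real
    have "\<bar>x\<bar> powr (\<alpha> - 1) \<le> 1" if "1 \<le> x"
      using that \<alpha> powr_mono[of "\<alpha> - 1" 0 x] by simp
    then show "ennreal (\<bar>?f x\<bar>\<^sup>2 * ?w x) \<le> indicator {1..2} x"
      by (auto simp: indicator_def power_weight_def)
  qed
  then have J1: "J \<le> 1" by simp
  then obtain j where j: "J = ennreal j" "0 < j" "j \<le> 1"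
    using J0 by (cases J) (auto simp: top_unique)
  have L: "L2_norm ?w ?f = ennreal (sqrt j)"
    using j unfolding L2_norm_def J_def[symmetric] by (simp add: sqrt_ennreal_ennreal)
  have "ennreal (real N / 2) = (\<integral>\<^sup>+x\<in>{0..(1/2)^N}. ennreal (?w x) \<partial>lebesgue)"
  proof -
    have "((1/2::real)^N) powr \<alpha> = 1/2"
      using assms by (simp add: \<alpha>_def powr_powr flip: powr_realpow)
    moreover have "(1/2) / \<alpha> = real N / 2" by (simp add: \<alpha>_def)
    ultimately show ?thesis
      using nn_integral_power_weight[of \<alpha> "(1/2)^N"] \<alpha> by (simp add: nn_integral_completion)
  qed
  also have "\<dots> \<le> (\<integral>\<^sup>+x\<in>?G. ennreal (?w x) \<partial>lebesgue)"
  proof (intro nn_integral_mono mult_left_mono)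
    fix x :: real
    show "indicator {0..(1/2)^N} x \<le> (indicator ?G x :: ennreal)"
    proof (cases "x \<in> {0..(1/2)^N}")
      case True
      \<comment> \<open>The \<open>N + 1\<close> terms push the operator strictly above N/2, as
        membership in \<open>?G\<close> requires.\<close>
      have "ennreal (real N / 2) < ennreal (real (Suc N) / 2)" by (intro ennreal_lessI) auto
      also have "\<dots> \<le> ?T x" using True by (rule strong_sparse_op_dyadic_ge)
      finally show ?thesis by (simp add: indicator_def)
    qed simp
  qed simp
  finally have "sqrt_ennreal (ennreal (real N / 2)) \<le> sqrt_ennreal (\<integral>\<^sup>+x\<in>?G. ennreal (?w x) \<partial>lebesgue)"
    by (rule sqrt_ennreal_mono)
  then have "ennreal (real N / 2) * ennreal (sqrt (real N / 2))
      \<le> ennreal (real N / 2) * sqrt_ennreal (\<integral>\<^sup>+x\<in>?G. ennreal (?w x) \<partial>lebesgue)"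
    by (intro mult_left_mono) (auto simp: sqrt_ennreal_ennreal)
  also have "\<dots> \<le> weak_L2_norm ?w ?T"
    unfolding weak_L2_norm_def using assms by (intro SUP_upper) auto
  finally have "ennreal (real N / 2) * ennreal (sqrt (real N / 2)) \<le> weak_L2_norm ?w ?T" .
  moreover have "ennreal (real N / 2) * ennreal (sqrt (real N / 2)) = ennreal ((real N / 2) powr (3/2))"
    using assms powr_add[of "real N / 2" 1 "1/2"]
    by (simp add: powr_half_sqrt flip: ennreal_mult)
  ultimately have "ennreal ((real N / 2) powr (3/2)) \<le> weak_L2_norm ?w ?T" by simp
  also have "\<dots> \<le> weak_L2_norm ?w ?T / L2_norm ?w ?f"
  proof (rule ennreal_le_divide_mult)
    have "L2_norm ?w ?f \<le> 1" using j by (simp add: L)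
    then have "L2_norm ?w ?f * weak_L2_norm ?w ?T \<le> 1 * weak_L2_norm ?w ?T"
      by (rule mult_right_mono) simp
    then show "L2_norm ?w ?f * weak_L2_norm ?w ?T \<le> weak_L2_norm ?w ?T" by simp
  qed (use j L in auto)
  also have "?f \<in> borel_measurable lebesgue" by (intro borel_measurable_indicator) auto
  then have "weak_L2_norm ?w ?T / L2_norm ?w ?f \<le> op_norm_L2 ?w (weak_L2_norm ?w) (strong_sparse_op dyadic_family)"
    unfolding op_norm_L2_def using j L by (intro SUP_upper) auto
  finally show ?thesis by (simp add: \<alpha>_def)
qed

section \<open>Comparison with growth slower than the power 3/2, and the conclusion\<close>

text \<open>Eventually \<open>\<phi>\<close> stays below any prescribed multiple of the power 3/2,
  while \<open>T\<close> stays above a fixed one. Where \<open>\<phi>\<close> vanishes,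
  \<open>quot_top\<close> is \<open>top\<close> by convention.\<close>

lemma quot_top_tendsto_top:
  fixes T c :: "nat \<Rightarrow> ennreal" and \<phi> :: "real \<Rightarrow> real"
  assumes "K > 0" and T: "\<And>n. ennreal (K * enn2real (c n) powr (3/2)) \<le> T n"
    and c: "filterlim (\<lambda>n. enn2real (c n)) at_top sequentially"
    and \<phi>: "\<And>x. 0 \<le> x \<Longrightarrow> 0 \<le> \<phi> x" "((\<lambda>x. \<phi> x / x powr (3/2)) \<longlongrightarrow> 0) at_top"
  shows "(\<lambda>n. quot_top (T n) (ennreal (\<phi> (enn2real (c n))))) \<longlonglongrightarrow> top"
  unfolding tendsto_top_iff_ennreal
proof (intro allI impI)
  fix l :: real assume l: "0 \<le> l"
  \<comment> \<open>This makes \<open>K / \<epsilon> = l + 1\<close>, which leaves room for a strict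
    inequality and covers \<open>l = 0\<close>.\<close>
  define \<epsilon> where "\<epsilon> = K / (l + 1)"
  have \<epsilon>: "0 < \<epsilon>" using l \<open>K > 0\<close> by (simp add: \<epsilon>_def)
  have "\<forall>\<^sub>F x in at_top. \<phi> x / x powr (3/2) < \<epsilon>" using \<phi>(2) \<epsilon> by (rule order_tendstoD)
  with eventually_gt_at_top[of 0] have "\<forall>\<^sub>F x in at_top. 0 < x \<and> \<phi> x / x powr (3/2) < \<epsilon>"
    by eventually_elim auto
  then have "\<forall>\<^sub>F n in sequentially. 0 < enn2real (c n) \<and> \<phi> (enn2real (c n)) / enn2real (c n) powr (3/2) < \<epsilon>"
    using c unfolding filterlim_iff by blast
  then show "\<forall>\<^sub>F n in sequentially. ennreal l < quot_top (T n) (ennreal (\<phi> (enn2real (c n))))"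
  proof eventually_elim
    case (elim n)
    define x where "x = enn2real (c n)"
    have x: "0 < x" "\<phi> x < \<epsilon> * x powr (3/2)" using elim by (auto simp: x_def pos_divide_less_eq)
    show ?case
    proof (cases "\<phi> x = 0")
      case True
      then show ?thesis by (simp add: quot_top_def flip: x_def)
    next
      case False
      then have p: "0 < \<phi> x" using \<phi>(1)[of x] x by simp
      have "l * \<phi> x < (l + 1) * \<phi> x" using p by simp
      also have "\<dots> \<le> (l + 1) * (\<epsilon> * x powr (3/2))" using x l by (intro mult_left_mono) auto
      also have "\<dots> = K * x powr (3/2)" using l by (simp add: \<epsilon>_def)
      finally have "ennreal l < ennreal (K * x powr (3/2) / \<phi> x)"
        using p l by (intro ennreal_lessI) (auto simp: pos_less_divide_eq intro: le_less_trans[rotated])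
      also have "\<dots> = ennreal (K * x powr (3/2)) / ennreal (\<phi> x)"
        using p \<open>K > 0\<close> by (intro divide_ennreal[symmetric]) auto
      also have "\<dots> \<le> T n / ennreal (\<phi> x)"
        using T[of n] unfolding x_def by (rule divide_right_mono_ennreal)
      finally show ?thesis using p by (simp add: quot_top_def flip: x_def)
    qed
  qed
qed

theorem theorem1:
  shows "(\<forall>\<gamma>::real. 0 < \<gamma> \<and> \<gamma> < 1 \<longrightarrow>
           (\<exists>C::real. \<forall>S w. gamma_sparse \<gamma> S \<and> A2_weight w \<longrightarrow>
              op_norm_L2 w (weak_L2_norm w) (strong_sparse_op S)
                \<le> ennreal (C * enn2real (A2_char w) powr (3/2))))
       \<and> (\<exists>(S :: real set set) (\<alpha> :: nat \<Rightarrow> real) (w :: real \<Rightarrow> real \<Rightarrow> real).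
            sparse_family S
          \<and> (\<forall>n. \<alpha> n > 0) \<and> \<alpha> \<longlonglongrightarrow> 0
          \<and> (\<forall>n. A2_weight (w (\<alpha> n)))
          \<and> (\<lambda>n. A2_char (w (\<alpha> n))) \<longlonglongrightarrow> top
          \<and> (\<forall>\<phi> :: real \<Rightarrow> real.
               (\<forall>x\<ge>0. \<phi> x \<ge> 0) \<and> ((\<lambda>x. \<phi> x / x powr (3/2)) \<longlongrightarrow> 0) at_top \<longrightarrow>
               (\<lambda>n. quot_top
                      (op_norm_L2 (w (\<alpha> n)) (weak_L2_norm (w (\<alpha> n))) (strong_sparse_op S))
                      (ennreal (\<phi> (enn2real (A2_char (w (\<alpha> n)))))))
                 \<longlonglongrightarrow> top))"
proof (rule conjI)
  show "\<forall>\<gamma>::real. 0 < \<gamma> \<and> \<gamma> < 1 \<longrightarrow>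
           (\<exists>C::real. \<forall>S w. gamma_sparse \<gamma> S \<and> A2_weight w \<longrightarrow>
              op_norm_L2 w (weak_L2_norm w) (strong_sparse_op S)
                \<le> ennreal (C * enn2real (A2_char w) powr (3/2)))"
    \<comment> \<open>The witness for \<open>C\<close> is
      \<open>16 / \<gamma>\<^sup>2\<close>.\<close>
    using strong_sparse_op_weak_bound by blast
next
  define \<alpha> where "\<alpha> = (\<lambda>n. 1 / real (Suc n))"
  define c where "c = (\<lambda>n. A2_char (power_weight (\<alpha> n)))"
  have \<alpha>: "0 < \<alpha> n" "\<alpha> n \<le> 1" for n by (auto simp: \<alpha>_def)
  have c_le: "c n \<le> ennreal (4 * real (Suc n))" for n
    using A2_char_power_weight_le[OF \<alpha>, of n] by (simp add: c_def \<alpha>_def)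
  \<comment> \<open>\<open>enn2real\<close> sends \<open>top\<close> to 0, so the passage to real
    values rests on this finiteness.\<close>
  have c_fin: "c n < top" for n
    using c_le[of n] by (rule le_less_trans) simp
  have c_ge: "ennreal (real (Suc n) / 2) \<le> c n" for n
    using A2_char_power_weight_ge[OF \<alpha>, of n] by (simp add: c_def \<alpha>_def)
  have c_real: "c n = ennreal (enn2real (c n))" for n using c_fin[of n] by simp
  have "real (Suc n) / 2 \<le> enn2real (c n)" for n
    using enn2real_mono[OF c_ge c_fin, of n] by simp
  moreover have "filterlim (\<lambda>n. real (Suc n) / 2) at_top sequentially"
    by (rule filterlim_at_top_mono[OF filterlim_tendsto_pos_mult_at_top[of "\<lambda>_. 1/2" "1/2" _ real]])
      (auto intro: filterlim_real_sequentially)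
  ultimately have lim: "filterlim (\<lambda>n. enn2real (c n)) at_top sequentially"
    by (auto intro: filterlim_at_top_mono)
  have c_top: "c \<longlonglongrightarrow> top"
    unfolding tendsto_top_iff_ennreal
  proof (intro allI impI)
    fix l :: real assume "0 \<le> l"
    have "\<forall>\<^sub>F n in sequentially. l < enn2real (c n)"
      using lim unfolding filterlim_at_top_dense by blast
    then show "\<forall>\<^sub>F n in sequentially. ennreal l < c n"
      by eventually_elim (subst c_real, rule ennreal_lessI, use \<open>0 \<le> l\<close> in auto)
  qed
  \<comment> \<open>By \<open>c_le\<close>, one eighth of the characteristic is at most
    \<open>real (Suc n) / 2\<close>; this turns the operator bound in terms of \<open>n\<close> into
    one in terms of the characteristic.\<close>
  have T: "ennreal ((1/8) powr (3/2) * enn2real (c n) powr (3/2))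
      \<le> op_norm_L2 (power_weight (\<alpha> n)) (weak_L2_norm (power_weight (\<alpha> n))) (strong_sparse_op dyadic_family)" for n
  proof -
    have "enn2real (c n) \<le> 4 * real (Suc n)"
      by (rule enn2real_leI[OF _ c_le]) simp
    then have "(1/8 * enn2real (c n)) powr (3/2) \<le> (real (Suc n) / 2) powr (3/2)"
      by (intro powr_mono2) auto
    then have "ennreal ((1/8) powr (3/2) * enn2real (c n) powr (3/2)) \<le> ennreal ((real (Suc n) / 2) powr (3/2))"
      by (intro ennreal_leI) (subst powr_mult[symmetric], auto)
    also have "\<dots> \<le> op_norm_L2 (power_weight (\<alpha> n)) (weak_L2_norm (power_weight (\<alpha> n))) (strong_sparse_op dyadic_family)"
      unfolding \<alpha>_def by (rule op_norm_power_weight_ge) simp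
    finally show ?thesis .
  qed
  show "\<exists>(S :: real set set) (\<alpha> :: nat \<Rightarrow> real) (w :: real \<Rightarrow> real \<Rightarrow> real).
            sparse_family S
          \<and> (\<forall>n. \<alpha> n > 0) \<and> \<alpha> \<longlonglongrightarrow> 0
          \<and> (\<forall>n. A2_weight (w (\<alpha> n)))
          \<and> (\<lambda>n. A2_char (w (\<alpha> n))) \<longlonglongrightarrow> top
          \<and> (\<forall>\<phi> :: real \<Rightarrow> real.
               (\<forall>x\<ge>0. \<phi> x \<ge> 0) \<and> ((\<lambda>x. \<phi> x / x powr (3/2)) \<longlongrightarrow> 0) at_top \<longrightarrow>
               (\<lambda>n. quot_top
                      (op_norm_L2 (w (\<alpha> n)) (weak_L2_norm (w (\<alpha> n))) (strong_sparse_op S))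
                      (ennreal (\<phi> (enn2real (A2_char (w (\<alpha> n)))))))
                 \<longlonglongrightarrow> top)"
  proof (intro exI[of _ dyadic_family] exI[of _ \<alpha>] exI[of _ power_weight] conjI allI impI)
    show "\<alpha> \<longlonglongrightarrow> 0"
      unfolding \<alpha>_def using LIMSEQ_inverse_real_of_nat by (simp add: inverse_eq_divide)
    show "A2_weight (power_weight (\<alpha> n))" for n
      using weight_power_weight c_fin[of n] by (simp add: A2_weight_def c_def)
    show "(\<lambda>n. A2_char (power_weight (\<alpha> n))) \<longlonglongrightarrow> top" using c_top by (simp add: c_def)
    fix \<phi> :: "real \<Rightarrow> real"
    assume "(\<forall>x\<ge>0. \<phi> x \<ge> 0) \<and> ((\<lambda>x. \<phi> x / x powr (3/2)) \<longlongrightarrow> 0) at_top"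
    then have \<phi>: "\<And>x. 0 \<le> x \<Longrightarrow> 0 \<le> \<phi> x" "((\<lambda>x. \<phi> x / x powr (3/2)) \<longlongrightarrow> 0) at_top" by auto
    show "(\<lambda>n. quot_top
          (op_norm_L2 (power_weight (\<alpha> n)) (weak_L2_norm (power_weight (\<alpha> n))) (strong_sparse_op dyadic_family))
          (ennreal (\<phi> (enn2real (A2_char (power_weight (\<alpha> n))))))) \<longlonglongrightarrow> top"
      using quot_top_tendsto_top[OF _ T lim \<phi>] by (simp add: c_def)
  qed (use sparse_dyadic_family \<alpha> in auto)
qed

end
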